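(* If $A$ is a valid formula, then (i) $\mathsf{D_C}\vdash^{<\varphi_2 0}_{0}A$, and (ii) $\mathsf{G_C}\vdash^{<\varphi_2 0}_{0}A$.
   Context: Fix $h\ge1$ agents. Formulas: $A::=p\mid\bar p\mid A\vee A\mid A\wedge A\mid\Diamond_iA\mid\Box_iA\mid\widetilde{\mathsf C}A\mid\mathsf CA$ ($1\le i\le h$), $\widetilde{\mathsf C}$ the De Morgan dual of $\mathsf C$; $\bar A$ by De Morgan laws. $\Box A:=\Box_1A\wedge\dots\wedge\Box_hA$, $\Diamond A:=\Diamond_1A\vee\dots\vee\Diamond_hA$, $\Box^k,\Diamond^k$ iterations. Validity: truth at all states of all Kripke models $(S,\to_1,\dots,\to_h,V)$, where $\Box_i,\Diamond_i$ are interpreted via $\to_i$ and $s\models\mathsf CA$ iff $t\models A$ for every $t$ reachable from $s$ by a path of length $\ge1$ in $\to_1\cup\dots\cup\to_h$ (dually for $\widetilde{\mathsf C}$); equivalently, provability in the standard Hilbert system for the multi-agent logic $\mathsf K$ with common knowledge. Nested sequents: finite multisets of formulas and boxed sequents $[\Delta]_i$; contexts $\Gamma\{\ \}$. System $\mathsf{D_C}$ (premises / conclusion): axiom $\Gamma\{p,\bar p\}$; $\wedge$: $\Gamma\{A\},\Gamma\{B\}/\Gamma\{A\wedge B\}$; $\vee$: $\Gamma\{A,B\}/\Gamma\{A\vee B\}$; $\Box_i$: $\Gamma\{[A]_i\}/\Gamma\{\Box_iA\}$; $\Diamond_i$: $\Gamma\{\Diamond_iA,[\Delta,A]_i\}/\Gamma\{\Diamond_iA,[\Delta]_i\}$;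 $\mathsf C$: premises $\Gamma\{\Box^kA\}$, all $k\ge1$ / $\Gamma\{\mathsf CA\}$; $\widetilde{\mathsf C}$: $\Gamma\{\widetilde{\mathsf C}A,\Diamond^kA\}/\Gamma\{\widetilde{\mathsf C}A\}$ (some $k\ge1$). A shallow sequent is a finite multiset of formulas; $\Diamond_i\Gamma$, $\widetilde{\mathsf C}\Gamma$ prefix each element. System $\mathsf{G_C}$: axiom $\Gamma,p,\bar p$; $\wedge$: $\Gamma,A$ and $\Gamma,B$ / $\Gamma,A\wedge B$; $\vee$: $\Gamma,A,B/\Gamma,A\vee B$; $\Box_i$: $\Gamma,\widetilde{\mathsf C}\Delta,A\,/\,\Diamond_i\Gamma,\widetilde{\mathsf C}\Delta,\Box_iA,\Sigma$; $\mathsf C$: premises $\Gamma,\Box^kA$ for all $k\ge1$ / $\Gamma,\mathsf CA$; $\widetilde{\mathsf C}$: $\Gamma,\widetilde{\mathsf C}A,\Diamond A/\Gamma,\widetilde{\mathsf C}A$. Proofs: well-founded possibly infinitely branching trees with axiom leaves; depth = least ordinal greater than depths of immediate subproofs. $\mathcal S\vdash^{<\alpha}_0 A$: there is a cut-free proof of $A$ in $\mathcal S$ of depth $<\alpha$. Veblen function: $\varphi_0\beta=\omega^\beta$; for $\alpha>0$, $\varphi_\alpha\beta$ is the $(\beta+1)$-th common fixpoint of $\xi\mapsto\varphi_\gamma\xi$ for all $\gamma<\alpha$; $\varphi_2 0$ is the least common fixpoint of $\xi\mapsto\varphi_0\xi$ and $\xi\mapsto\varphi_1\xi$. *)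

theory Defs
  imports "HOL-Library.Multiset" "HOL-Library.Countable_Set" "HOL-Library.Infinite_Typeclass"
begin

section \<open>Countable ordinals and the Veblen function\<close>

text \<open>
  The type \<open>cord\<close> is the first uncountable cardinal, i.e. the well-ordered set of all countable
  ordinals. Every inference rule below has countably many premises, so that every proof has a
  countable depth, and the ordinal \<open>\<phi>\<^sub>2 0\<close> is countable as well.
\<close>

typedef cord = "Field (cardSuc natLeq)"
  using Field_cardSuc_not_empty[OF natLeq_Card_order] by blast

instantiation cord :: wellorder
begin

definition less_eq_cord :: "cord \<Rightarrow> cord \<Rightarrow> bool"
  where "\<alpha> \<le> \<beta> \<longleftrightarrow> (Rep_cord \<alpha>, Rep_cord \<beta>) \<in> cardSuc natLeq"

definition less_cord :: "cord \<Rightarrow> cord \<Rightarrow> bool"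
  where "\<alpha> < \<beta> \<longleftrightarrow> \<alpha> \<le> \<beta> \<and> \<alpha> \<noteq> (\<beta> :: cord)"

instance
proof -
  have wo: "Well_order (cardSuc natLeq)"
    using cardSuc_Card_order[OF natLeq_Card_order] by (simp add: card_order_on_def)
  have r: "refl_on (Field (cardSuc natLeq)) (cardSuc natLeq)"
    and t: "trans (cardSuc natLeq)" and a: "antisym (cardSuc natLeq)"
    and tot: "total_on (Field (cardSuc natLeq)) (cardSuc natLeq)"
    and w: "wf (cardSuc natLeq - Id)"
    using wo unfolding well_order_on_def linear_order_on_def partial_order_on_def preorder_on_def
    by auto
  have refl: "\<alpha> \<le> \<alpha>" for \<alpha> :: cord
    unfolding less_eq_cord_def using r Rep_cord by (auto simp: refl_on_def)
  have anti: "\<alpha> = \<beta>" if "\<alpha> \<le> \<beta>" "\<beta> \<le> \<alpha>" for \<alpha> \<beta> :: cord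
    using that a unfolding less_eq_cord_def by (metis Rep_cord_inject antisymD)
  show "OFCLASS(cord, wellorder_class)"
  proof (intro_classes, goal_cases)
    case (1 x y) then show ?case unfolding less_cord_def using anti refl by auto
  next
    case (2 x) then show ?case by (rule refl)
  next
    case (3 x y z) then show ?case unfolding less_eq_cord_def using t by (blast dest: transD)
  next
    case (4 x y) then show ?case by (rule anti)
  next
    case (5 x y)
    show ?case
      using tot Rep_cord[of x] Rep_cord[of y] refl[of x]
      unfolding less_eq_cord_def total_on_def by (metis Rep_cord_inject)
  next
    case (6 P a)
    have "wf (inv_image (cardSuc natLeq - Id) Rep_cord)" using w by (rule wf_inv_image)
    then show ?case
    proof (rule wf_induct_rule)
      fix x assume "\<And>y. (y, x) \<in> inv_image (cardSuc natLeq - Id) Rep_cord \<Longrightarrow> P y"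
      then show "P x" using 6 
        by (auto simp: in_inv_image less_cord_def less_eq_cord_def Rep_cord_inject)
    qed
  qed
qed

end

lemma cord_countable_atMost:
  includes cardinal_syntax
  shows "countable {..(\<beta> :: cord)}"
proof -
  let ?r = "cardSuc natLeq"
  have C: "Card_order ?r" by (rule cardSuc_Card_order[OF natLeq_Card_order])
  have "|underS ?r (Rep_cord \<beta>)| <o ?r"
    by (rule card_of_underS[OF C Rep_cord])
  then have "|underS ?r (Rep_cord \<beta>)| \<le>o natLeq"
    using cardSuc_ordLeq_ordLess[OF natLeq_Card_order card_of_Card_order] by blast
  then have "|underS ?r (Rep_cord \<beta>)| \<le>o |UNIV :: nat set|"
    using card_of_nat ordIso_symmetric ordLeq_ordIso_trans by blast
  then have "countable (underS ?r (Rep_cord \<beta>))"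
    unfolding countable_def card_of_ordLeq[symmetric] by blast
  moreover have "Rep_cord ` {..<\<beta>} \<subseteq> underS ?r (Rep_cord \<beta>)"
    by (auto simp: underS_def less_cord_def less_eq_cord_def Rep_cord_inject)
  ultimately have "countable (Rep_cord ` {..<\<beta>})" by (rule countable_subset[rotated])
  then have "countable {..<\<beta>}"
    by (rule countable_image_inj_on) (auto simp: inj_on_def Rep_cord_inject)
  moreover have "{..\<beta>} = insert \<beta> {..<\<beta>}" by auto
  ultimately show ?thesis by simp
qed

lemma cord_uncountable:
  includes cardinal_syntax
  shows "uncountable (UNIV :: cord set)"
proof
  assume "countable (UNIV :: cord set)"
  then have "countable (range Rep_cord)" by simp
  moreover have "range Rep_cord = Field (cardSuc natLeq)"
    using type_definition.Rep_range[OF type_definition_cord] .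
  ultimately have "|Field (cardSuc natLeq)| \<le>o |UNIV :: nat set|"
    unfolding countable_def card_of_ordLeq[symmetric] by auto
  then have "cardSuc natLeq \<le>o natLeq"
    using card_of_nat card_of_Field_ordIso[OF cardSuc_Card_order[OF natLeq_Card_order]]
    by (meson ordIso_ordLeq_trans ordIso_symmetric ordLeq_ordIso_trans)
  with cardSuc_greater[OF natLeq_Card_order] show False
    using not_ordLess_ordLeq by blast
qed

lemma cord_bounded:
  assumes "countable X"
  shows "\<exists>\<alpha> :: cord. \<forall>\<beta>\<in>X. \<beta> < \<alpha>"
proof -
  have "countable (\<Union>\<beta>\<in>X. {..\<beta>})"
    using assms cord_countable_atMost by blast
  then have "(\<Union>\<beta>\<in>X. {..\<beta>}) \<noteq> UNIV" using cord_uncountable by auto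
  then obtain \<alpha> where "\<alpha> \<notin> (\<Union>\<beta>\<in>X. {..\<beta>})" by blast
  then show ?thesis by (intro exI[of _ \<alpha>]) (auto simp: not_le)
qed

text \<open>The least ordinal greater than all elements of \<open>X\<close>; it exists for countable \<open>X\<close>.\<close>

definition slub :: "cord set \<Rightarrow> cord"
  where "slub X = (LEAST \<alpha>. \<forall>\<beta>\<in>X. \<beta> < \<alpha>)"

text \<open>
  Ordinal arithmetic, with the base, successor and limit clauses merged:
  \<open>\<alpha> + \<beta> = max \<alpha> (sup {(\<alpha> + \<gamma>) + 1 | \<gamma> < \<beta>})\<close>, \<open>\<alpha> \<cdot> \<beta> = sup {\<alpha> \<cdot> \<gamma> + \<alpha> | \<gamma> < \<beta>}\<close>,
  \<open>\<omega>\<^sup>\<beta> = max 1 (sup {\<omega>\<^sup>\<gamma> \<cdot> \<omega> | \<gamma> < \<beta>})\<close>.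
  The recursion equations loop as rewrite rules.
\<close>

instantiation cord :: "{zero, one, plus, times}"
begin

definition zero_cord :: cord where "0 = slub {}"

definition one_cord :: cord where "1 = slub {0}"

function plus_cord :: "cord \<Rightarrow> cord \<Rightarrow> cord"
  where "plus_cord \<alpha> \<beta> = (LEAST \<delta>. \<alpha> \<le> \<delta> \<and> (\<forall>\<gamma>\<in>{..<\<beta>}. plus_cord \<alpha> \<gamma> < \<delta>))"
  by auto
termination by (relation "inv_image {(\<gamma>, \<beta>). \<gamma> < \<beta>} snd") (auto simp: wf)
declare plus_cord.simps [simp del]

function times_cord :: "cord \<Rightarrow> cord \<Rightarrow> cord"
  where "times_cord \<alpha> \<beta> = (LEAST \<delta>. \<forall>\<gamma>\<in>{..<\<beta>}. times_cord \<alpha> \<gamma> + \<alpha> \<le> \<delta>)"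
  by auto
termination by (relation "inv_image {(\<gamma>, \<beta>). \<gamma> < \<beta>} snd") (auto simp: wf)
declare times_cord.simps [simp del]

instance ..

end

definition omega :: cord
  where "omega = (LEAST \<delta>. 0 < \<delta> \<and> (\<forall>\<gamma><\<delta>. \<gamma> + 1 < \<delta>))"

function omega_pow :: "cord \<Rightarrow> cord"
  where "omega_pow \<beta> = (LEAST \<delta>. 1 \<le> \<delta> \<and> (\<forall>\<gamma>\<in>{..<\<beta>}. omega_pow \<gamma> * omega \<le> \<delta>))"
  by auto
termination by (relation "{(\<gamma>, \<beta>). \<gamma> < \<beta>}") (auto simp: wf)
declare omega_pow.simps [simp del]

text \<open>\<open>enum_ord X \<beta>\<close> is the \<open>(\<beta>+1)\<close>-th element of \<open>X\<close>.\<close>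

function enum_ord :: "cord set \<Rightarrow> cord \<Rightarrow> cord"
  where "enum_ord X \<beta> = (LEAST \<xi>. \<xi> \<in> X \<and> (\<forall>\<gamma>\<in>{..<\<beta>}. enum_ord X \<gamma> < \<xi>))"
  by auto
termination by (relation "inv_image {(\<gamma>, \<beta>). \<gamma> < \<beta>} snd") (auto simp: wf)
declare enum_ord.simps [simp del]

function veblen :: "cord \<Rightarrow> cord \<Rightarrow> cord"
  where "veblen \<alpha> = (if \<alpha> = 0 then omega_pow else enum_ord {\<xi>. \<forall>\<gamma>\<in>{..<\<alpha>}. veblen \<gamma> \<xi> = \<xi>})"
  by auto
termination by (relation "{(\<gamma>, \<alpha>). \<gamma> < \<alpha>}") (auto simp: wf)
declare veblen.simps [simp del]


section \<open>Formulas and Kripke semantics\<close>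

text \<open>
  The agents are the elements of a type \<open>'i\<close> of class \<open>{finite, linorder}\<close>, which plays the role of
  \<open>{1, \<dots>, h}\<close> for \<open>h = CARD('i) \<ge> 1\<close>; the linear order fixes the order of the conjuncts of \<open>\<box>A\<close>
  and of the disjuncts of \<open>\<diamond>A\<close>. \<open>CK\<close> is the common knowledge operator and \<open>DualCK\<close> its De Morgan dual.
\<close>

datatype ('p, 'i) fm =
    Pos 'p
  | Neg 'p
  | Or "('p, 'i) fm" "('p, 'i) fm"
  | And "('p, 'i) fm" "('p, 'i) fm"
  | Dia 'i "('p, 'i) fm"
  | Box 'i "('p, 'i) fm"
  | DualCK "('p, 'i) fm"
  | CK "('p, 'i) fm"

fun conj_list :: "('p, 'i) fm list \<Rightarrow> ('p, 'i) fm" where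
  "conj_list [A] = A"
| "conj_list (A # B # As) = And A (conj_list (B # As))"

fun disj_list :: "('p, 'i) fm list \<Rightarrow> ('p, 'i) fm" where
  "disj_list [A] = A"
| "disj_list (A # B # As) = Or A (disj_list (B # As))"

definition box_all :: "('p, 'i::{finite,linorder}) fm \<Rightarrow> ('p, 'i) fm"
  where "box_all A = conj_list (map (\<lambda>i. Box i A) (sorted_list_of_set UNIV))"

definition dia_all :: "('p, 'i::{finite,linorder}) fm \<Rightarrow> ('p, 'i) fm"
  where "dia_all A = disj_list (map (\<lambda>i. Dia i A) (sorted_list_of_set UNIV))"

record ('s, 'p, 'i) kripke =
  states :: "'s set"
  acc :: "'i \<Rightarrow> 's rel"
  val :: "'p \<Rightarrow> 's set"

definition is_kripke :: "('s, 'p, 'i) kripke \<Rightarrow> bool"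
  where "is_kripke M \<longleftrightarrow> states M \<noteq> {} \<and> (\<forall>i. acc M i \<subseteq> states M \<times> states M) \<and> (\<forall>p. val M p \<subseteq> states M)"

primrec sat :: "('s, 'p, 'i) kripke \<Rightarrow> 's \<Rightarrow> ('p, 'i) fm \<Rightarrow> bool" where
  "sat M s (Pos p) \<longleftrightarrow> s \<in> val M p"
| "sat M s (Neg p) \<longleftrightarrow> s \<notin> val M p"
| "sat M s (Or A B) \<longleftrightarrow> sat M s A \<or> sat M s B"
| "sat M s (And A B) \<longleftrightarrow> sat M s A \<and> sat M s B"
| "sat M s (Dia i A) \<longleftrightarrow> (\<exists>t. (s, t) \<in> acc M i \<and> sat M t A)"
| "sat M s (Box i A) \<longleftrightarrow> (\<forall>t. (s, t) \<in> acc M i \<longrightarrow> sat M t A)"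
| "sat M s (DualCK A) \<longleftrightarrow> (\<exists>t. (s, t) \<in> (\<Union>i. acc M i)\<^sup>+ \<and> sat M t A)"
| "sat M s (CK A) \<longleftrightarrow> (\<forall>t. (s, t) \<in> (\<Union>i. acc M i)\<^sup>+ \<longrightarrow> sat M t A)"

text \<open>
  HOL cannot quantify over all types of states, so the universe \<open>'s\<close> from which the states are drawn
  is a parameter of the notion of validity. It is required to be infinite: over a finite universe,
  non-valid formulas can hold in all models.
\<close>

definition valid :: "'s::infinite itself \<Rightarrow> ('p, 'i) fm \<Rightarrow> bool"
  where "valid TYPE('s) A \<longleftrightarrow>
    (\<forall>M :: ('s, 'p, 'i) kripke. is_kripke M \<longrightarrow> (\<forall>s\<in>states M. sat M s A))"


section \<open>Proofs and their depths\<close>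

text \<open>
  An inference system is a relation \<open>R\<close> between the set of premises and the conclusion of an
  inference, axioms having no premises. \<open>proof_of_depth R \<alpha> S\<close> states that \<open>S\<close> is the root of a
  (well-founded) proof tree of depth exactly \<open>\<alpha>\<close>; \<open>d T\<close> is the depth of the immediate subproof
  of the premise \<open>T\<close>.
\<close>

inductive proof_of_depth :: "('a set \<Rightarrow> 'a \<Rightarrow> bool) \<Rightarrow> cord \<Rightarrow> 'a \<Rightarrow> bool"
  for R :: "'a set \<Rightarrow> 'a \<Rightarrow> bool" where
  "R P S \<Longrightarrow> (\<And>T. T \<in> P \<Longrightarrow> proof_of_depth R (d T) T) \<Longrightarrow> proof_of_depth R (slub (d ` P)) S"

definition provable_below :: "('a set \<Rightarrow> 'a \<Rightarrow> bool) \<Rightarrow> cord \<Rightarrow> 'a \<Rightarrow> bool"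
  where "provable_below R \<alpha> S \<longleftrightarrow> (\<exists>\<beta><\<alpha>. proof_of_depth R \<beta> S)"


section \<open>The nested sequent system \<open>D\<^sub>C\<close>\<close>

datatype ('p, 'i) item =
    Fm "('p, 'i) fm"
  | Br 'i "('p, 'i) item multiset"

type_synonym ('p, 'i) nested = "('p, 'i) item multiset"

text \<open>\<open>Hole \<Gamma>\<close> is the context \<open>\<Gamma>, { }\<close> and \<open>Nest \<Gamma> i c\<close> is the context \<open>\<Gamma>, [c{ }]\<^sub>i\<close>.\<close>

datatype ('p, 'i) ctx =
    Hole "('p, 'i) nested"
  | Nest "('p, 'i) nested" 'i "('p, 'i) ctx"

primrec plug :: "('p, 'i) ctx \<Rightarrow> ('p, 'i) nested \<Rightarrow> ('p, 'i) nested" where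
  "plug (Hole \<Gamma>) \<Delta> = \<Gamma> + \<Delta>"
| "plug (Nest \<Gamma> i c) \<Delta> = \<Gamma> + {# Br i (plug c \<Delta>) #}"

inductive DC :: "('p, 'i::{finite,linorder}) nested set \<Rightarrow> ('p, 'i) nested \<Rightarrow> bool" where
  DC_ax: "DC {} (plug c {# Fm (Pos p), Fm (Neg p) #})"
| DC_and: "DC {plug c {# Fm A #}, plug c {# Fm B #}} (plug c {# Fm (And A B) #})"
| DC_or: "DC {plug c {# Fm A, Fm B #}} (plug c {# Fm (Or A B) #})"
| DC_box: "DC {plug c {# Br i {# Fm A #} #}} (plug c {# Fm (Box i A) #})"
| DC_dia: "DC {plug c {# Fm (Dia i A), Br i (\<Delta> + {# Fm A #}) #}}
             (plug c {# Fm (Dia i A), Br i \<Delta> #})"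
| DC_ck: "DC {plug c {# Fm ((box_all ^^ k) A) #} | k. k \<ge> 1} (plug c {# Fm (CK A) #})"
| DC_dualck: "k \<ge> 1 \<Longrightarrow>
    DC {plug c {# Fm (DualCK A), Fm ((dia_all ^^ k) A) #}} (plug c {# Fm (DualCK A) #})"


section \<open>The shallow sequent system \<open>G\<^sub>C\<close>\<close>

type_synonym ('p, 'i) shallow = "('p, 'i) fm multiset"

inductive GC :: "('p, 'i::{finite,linorder}) shallow set \<Rightarrow> ('p, 'i) shallow \<Rightarrow> bool" where
  GC_ax: "GC {} (\<Gamma> + {# Pos p, Neg p #})"
| GC_and: "GC {\<Gamma> + {# A #}, \<Gamma> + {# B #}} (\<Gamma> + {# And A B #})"
| GC_or: "GC {\<Gamma> + {# A, B #}} (\<Gamma> + {# Or A B #})"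
| GC_box: "GC {\<Gamma> + image_mset DualCK \<Delta> + {# A #}}
             (image_mset (Dia i) \<Gamma> + image_mset DualCK \<Delta> + {# Box i A #} + \<Sigma>)"
| GC_ck: "GC {\<Gamma> + {# (box_all ^^ k) A #} | k. k \<ge> 1} (\<Gamma> + {# CK A #})"
| GC_dualck: "GC {\<Gamma> + {# DualCK A, dia_all A #}} (\<Gamma> + {# DualCK A #})"

end

theory Submission
  imports Defs
begin

text \<open>
  Proof by semantic completeness rather than by cut elimination. Call a finite set of formulas
  provable at level \<open>j\<close> if every sequent containing it has a cut-free proof of depth below \<open>\<lambda>\<^sub>j\<close>, where
  \<open>\<lambda>\<^sub>0 < \<lambda>\<^sub>1 < \<dots>\<close> are limit ordinals below \<open>\<phi>\<^sub>2 0\<close>. Finitary rules preserve the level, and the infinitary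
  rule raises it by one. As a formula \<open>A\<close> has finitely many sets of subformulas, there is a \<open>j\<close> such
  that levels \<open>j\<close> and \<open>j + 1\<close> agree on all of them. If \<open>A\<close> is not provable at level \<open>j\<close>, the sets that
  are not provable at level \<open>j\<close> form a countermodel: a world has to remember only one formula
  \<open>\<box>\<^sup>kB\<close> that is not a subformula of \<open>A\<close>, since the rule for \<open>\<box>\<^sub>i\<close> discards the others, and the
  agreement of the two levels provides the \<open>k\<close> that refutes \<open>C B\<close>.
\<close>

section \<open>Countable ordinals\<close>

text \<open>Zero is excluded, so an axiom fits below every such ordinal, and one more finitary
  inference always stays below.\<close>

definition limit_ord :: "cord \<Rightarrow> bool"
  where "limit_ord \<xi> \<longleftrightarrow> (\<exists>\<gamma>. \<gamma> < \<xi>) \<and> (\<forall>\<gamma><\<xi>. \<exists>\<delta>. \<gamma> < \<delta> \<and> \<delta> < \<xi>)"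

lemma countable_lessThan_cord: "countable {..<\<beta> :: cord}"
  by (rule countable_subset[OF _ cord_countable_atMost[of \<beta>]]) auto

text \<open>A recursive value at a countable ordinal has only countably many earlier values to
  dominate; the bound shows that the set under each \<open>LEAST\<close> in the ordinal recursions
  is inhabited.\<close>

lemma cord_strict_bound:
  fixes f :: "'a \<Rightarrow> cord"
  assumes "countable X"
  obtains \<delta> where "\<alpha> < \<delta>" "\<And>x. x \<in> X \<Longrightarrow> f x < \<delta>"
  using cord_bounded[of "insert \<alpha> (f ` X)"] assms by auto

lemma slub_le: "slub X \<le> \<alpha>" if "\<And>\<beta>. \<beta> \<in> X \<Longrightarrow> \<beta> < \<alpha>"
  unfolding slub_def using that by (intro Least_le) auto

lemma less_slub: "\<beta> < slub X" if "\<beta> \<in> X" "countable X"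
proof -
  obtain \<alpha> where "\<forall>\<beta>\<in>X. \<beta> < \<alpha>" using cord_bounded[OF \<open>countable X\<close>] by blast
  then have "\<forall>\<beta>\<in>X. \<beta> < slub X" unfolding slub_def by (rule LeastI)
  then show ?thesis using that by blast
qed

lemma zero_less_one_cord: "0 < (1 :: cord)"
  unfolding one_cord_def by (rule less_slub) auto

lemma strict_mono_ge_self: "x \<le> f x" if "strict_mono f" for f :: "'a::wellorder \<Rightarrow> 'a"
proof (rule ccontr)
  assume "\<not> x \<le> f x"
  then have *: "f x < x" by simp
  define y where "y = (LEAST y. f y < y)"
  have "f y < y" unfolding y_def by (rule LeastI) (rule *)
  then have "f (f y) < f y" using that by (simp add: strict_mono_def)
  then have "y \<le> f y" unfolding y_def by (intro Least_le)
  with \<open>f y < y\<close> show False by simp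
qed

section \<open>Ordinal arithmetic, closure points and powers of \<open>omega\<close>\<close>

lemma plus_cord_lower: "\<alpha> \<le> \<alpha> + (\<beta> :: cord)"
  and plus_cord_strict: "\<gamma> < \<beta> \<Longrightarrow> \<alpha> + \<gamma> < \<alpha> + (\<beta> :: cord)"
proof -
  obtain \<delta> where "\<alpha> < \<delta>" "\<And>\<gamma>. \<gamma> \<in> {..<\<beta>} \<Longrightarrow> \<alpha> + \<gamma> < \<delta>"
    by (rule cord_strict_bound[OF countable_lessThan_cord, where \<alpha> = \<alpha> and f = "\<lambda>\<gamma>. \<alpha> + \<gamma>"]) auto
  then have "\<alpha> \<le> \<delta> \<and> (\<forall>\<gamma>\<in>{..<\<beta>}. \<alpha> + \<gamma> < \<delta>)" by auto
  then have "\<alpha> \<le> \<alpha> + \<beta> \<and> (\<forall>\<gamma>\<in>{..<\<beta>}. \<alpha> + \<gamma> < \<alpha> + \<beta>)"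
    unfolding plus_cord.simps[of \<alpha> \<beta>] by (rule LeastI)
  then show "\<alpha> \<le> \<alpha> + \<beta>" "\<gamma> < \<beta> \<Longrightarrow> \<alpha> + \<gamma> < \<alpha> + \<beta>" by auto
qed

lemma less_plus_cord: "0 < \<beta> \<Longrightarrow> \<alpha> < \<alpha> + (\<beta> :: cord)"
  using plus_cord_lower plus_cord_strict le_less_trans by blast

lemma plus_cord_upper: "\<beta> \<le> \<alpha> + (\<beta> :: cord)"
  by (rule strict_mono_ge_self) (simp add: strict_mono_def plus_cord_strict)

lemma times_cord_ge: "\<gamma> < \<beta> \<Longrightarrow> \<alpha> * \<gamma> + \<alpha> \<le> \<alpha> * (\<beta> :: cord)"
proof -
  obtain \<delta> where "0 < \<delta>" "\<And>\<gamma>. \<gamma> \<in> {..<\<beta>} \<Longrightarrow> \<alpha> * \<gamma> + \<alpha> < \<delta>"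
    by (rule cord_strict_bound[OF countable_lessThan_cord, where \<alpha> = "0" and f = "\<lambda>\<gamma>. \<alpha> * \<gamma> + \<alpha>"]) auto
  then have "\<forall>\<gamma>\<in>{..<\<beta>}. \<alpha> * \<gamma> + \<alpha> \<le> \<delta>" by fastforce
  then have "\<forall>\<gamma>\<in>{..<\<beta>}. \<alpha> * \<gamma> + \<alpha> \<le> \<alpha> * \<beta>"
    unfolding times_cord.simps[of \<alpha> \<beta>] by (rule LeastI)
  then show "\<gamma> < \<beta> \<Longrightarrow> \<alpha> * \<gamma> + \<alpha> \<le> \<alpha> * (\<beta> :: cord)" by auto
qed

lemma less_times_cordE:
  assumes "\<delta> < \<alpha> * (\<beta> :: cord)"
  obtains \<gamma> where "\<gamma> < \<beta>" "\<delta> < \<alpha> * \<gamma> + \<alpha>"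
proof -
  have "\<not> (\<forall>\<gamma>\<in>{..<\<beta>}. \<alpha> * \<gamma> + \<alpha> \<le> \<delta>)"
    using assms unfolding times_cord.simps[of \<alpha> \<beta>] by (rule not_less_Least)
  then show thesis using that by (auto simp: not_le)
qed

text \<open>Iterate, along the natural numbers, a map \<open>g\<close> that jumps above its argument
  and above all values of \<open>F\<close> up to there. The supremum of the iterates is a limit
  closed under all of \<open>F\<close>; countability of \<open>F\<close> makes each jump
  possible.\<close>

lemma cord_closure_point:
  fixes F :: "(cord \<Rightarrow> cord) set"
  assumes "countable F"
  obtains \<xi> where "\<beta> < \<xi>" "limit_ord \<xi>" "\<And>f \<gamma>. f \<in> F \<Longrightarrow> \<gamma> < \<xi> \<Longrightarrow> f \<gamma> < \<xi>"
proof -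
  have "\<exists>\<delta>. \<alpha> < \<delta> \<and> (\<forall>f\<in>F. \<forall>\<gamma>\<le>\<alpha>. f \<gamma> < \<delta>)" for \<alpha>
  proof -
    have "countable (F \<times> {..\<alpha>})" using assms cord_countable_atMost by auto
    then obtain \<delta> where "\<alpha> < \<delta>" "\<And>y. y \<in> F \<times> {..\<alpha>} \<Longrightarrow> (\<lambda>(f, \<gamma>). f \<gamma>) y < \<delta>"
      by (rule cord_strict_bound[where \<alpha> = \<alpha> and f = "\<lambda>(f, \<gamma>). f \<gamma>"]) blast
    then show ?thesis by (intro exI[of _ \<delta>]) auto
  qed
  then obtain g where g: "\<And>\<alpha>. \<alpha> < g \<alpha> \<and> (\<forall>f\<in>F. \<forall>\<gamma>\<le>\<alpha>. f \<gamma> < g \<alpha>)" by metis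
  define x where "x n = (g ^^ n) \<beta>" for n
  have x0: "x 0 = \<beta>" and x: "\<And>n. x n < x (Suc n)"
    and xF: "\<And>n f \<gamma>. f \<in> F \<Longrightarrow> \<gamma> \<le> x n \<Longrightarrow> f \<gamma> < x (Suc n)"
    unfolding x_def using g by auto
  let ?\<xi> = "slub (range x)"
  have less: "x n < ?\<xi>" for n by (rule less_slub) auto
  have below: "\<exists>n. \<gamma> \<le> x n" if "\<gamma> < ?\<xi>" for \<gamma>
  proof (rule ccontr)
    assume "\<nexists>n. \<gamma> \<le> x n"
    then have "?\<xi> \<le> \<gamma>" by (intro slub_le) (auto simp: not_le)
    then show False using that by simp
  qed
  show thesis
  proof (rule that[of ?\<xi>])
    show "\<beta> < ?\<xi>" using less[of 0] x0 by simp
    show "limit_ord ?\<xi>" unfolding limit_ord_def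
      using less below x by (meson le_less_trans)
    show "f \<gamma> < ?\<xi>" if "f \<in> F" "\<gamma> < ?\<xi>" for f \<gamma>
      using below[OF that(2)] xF[OF that(1)] less less_trans by blast
  qed
qed

lemma omega_pos: "0 < omega"
  and omega_succ: "\<gamma> < omega \<Longrightarrow> \<gamma> + 1 < omega"
proof -
  obtain \<xi> :: cord where "0 < \<xi>" "\<And>\<gamma>. \<gamma> < \<xi> \<Longrightarrow> \<gamma> + 1 < \<xi>"
  proof (rule cord_closure_point[of "{\<lambda>\<gamma>. \<gamma> + 1}" 0])
    show "countable {\<lambda>\<gamma>. \<gamma> + 1 :: cord}" by simp
  qed blast
  then have "0 < \<xi> \<and> (\<forall>\<gamma><\<xi>. \<gamma> + 1 < \<xi>)" by blast
  then have "0 < omega \<and> (\<forall>\<gamma><omega. \<gamma> + 1 < omega)"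
    unfolding omega_def by (rule LeastI)
  then show "0 < omega" "\<gamma> < omega \<Longrightarrow> \<gamma> + 1 < omega" by auto
qed

text \<open>An ordinal below \<open>\<alpha> * omega\<close> lies below some
  \<open>\<alpha> * \<gamma> + \<alpha>\<close> with \<open>\<gamma> < omega\<close>. That sum is
  itself strictly below, since \<open>\<gamma> + 1 < omega\<close> leaves room for one more
  summand.\<close>

lemma
  assumes "0 < \<alpha>"
  shows limit_ord_times_omega: "limit_ord (\<alpha> * omega)"
    and less_times_omega: "\<alpha> < \<alpha> * omega"
proof -
  have step: "\<alpha> * \<gamma> + \<alpha> < \<alpha> * omega" if "\<gamma> < omega" for \<gamma>
  proof -
    have "\<alpha> * \<gamma> + \<alpha> \<le> \<alpha> * (\<gamma> + 1)"
      by (rule times_cord_ge) (rule less_plus_cord[OF zero_less_one_cord])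
    also have "\<dots> < \<alpha> * (\<gamma> + 1) + \<alpha>" by (rule less_plus_cord[OF assms])
    also have "\<dots> \<le> \<alpha> * omega" by (rule times_cord_ge[OF omega_succ[OF that]])
    finally show ?thesis .
  qed
  have "\<alpha> \<le> \<alpha> * 0 + \<alpha>" by (rule plus_cord_upper)
  also have "\<dots> < \<alpha> * omega" by (rule step[OF omega_pos])
  finally show "\<alpha> < \<alpha> * omega" .
  then show "limit_ord (\<alpha> * omega)"
    unfolding limit_ord_def using step by (blast elim: less_times_cordE)
qed

lemma one_le_omega_pow: "1 \<le> omega_pow \<beta>"
  and omega_pow_times_omega_le: "\<gamma> < \<beta> \<Longrightarrow> omega_pow \<gamma> * omega \<le> omega_pow \<beta>"
proof -
  obtain \<delta> where "1 < \<delta>" "\<And>\<gamma>. \<gamma> \<in> {..<\<beta>} \<Longrightarrow> omega_pow \<gamma> * omega < \<delta>"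
    by (rule cord_strict_bound[OF countable_lessThan_cord, where \<alpha> = "1" and f = "\<lambda>\<gamma>. omega_pow \<gamma> * omega"]) auto
  then have "1 \<le> \<delta> \<and> (\<forall>\<gamma>\<in>{..<\<beta>}. omega_pow \<gamma> * omega \<le> \<delta>)" by fastforce
  then have "1 \<le> omega_pow \<beta> \<and> (\<forall>\<gamma>\<in>{..<\<beta>}. omega_pow \<gamma> * omega \<le> omega_pow \<beta>)"
    unfolding omega_pow.simps[of \<beta>] by (rule LeastI)
  then show "1 \<le> omega_pow \<beta>" "\<gamma> < \<beta> \<Longrightarrow> omega_pow \<gamma> * omega \<le> omega_pow \<beta>" by auto
qed

lemma omega_pow_pos: "0 < omega_pow \<beta>"
  using zero_less_one_cord one_le_omega_pow by (rule less_le_trans)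

lemma strict_mono_omega_pow: "strict_mono omega_pow"
  using less_times_omega[OF omega_pow_pos] omega_pow_times_omega_le
  by (meson less_le_trans strict_monoI)

section \<open>Normal functions and the Veblen hierarchy\<close>

text \<open>Of continuity only a consequence is kept: a limit ordinal closed under \<open>f\<close>
  is a fixpoint. This is enough to find fixpoints and is inherited along the Veblen
  hierarchy.\<close>

definition normal_fun :: "(cord \<Rightarrow> cord) \<Rightarrow> bool"
  where "normal_fun f \<longleftrightarrow> strict_mono f \<and>
    (\<forall>\<xi>. limit_ord \<xi> \<longrightarrow> (\<forall>\<gamma><\<xi>. f \<gamma> < \<xi>) \<longrightarrow> f \<xi> = \<xi>)"

lemma normal_fun_omega_pow: "normal_fun omega_pow"
  unfolding normal_fun_def
proof (intro conjI allI impI strict_mono_omega_pow)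
  fix \<xi> assume lim: "limit_ord \<xi>" and closed: "\<forall>\<gamma><\<xi>. omega_pow \<gamma> < \<xi>"
  have "omega_pow \<gamma> * omega \<le> \<xi>" if "\<gamma> < \<xi>" for \<gamma>
    using lim closed that omega_pow_times_omega_le unfolding limit_ord_def
    by (meson less_imp_le order.trans)
  moreover have "1 \<le> \<xi>"
    using lim closed one_le_omega_pow unfolding limit_ord_def
    by (meson less_imp_le order.trans)
  ultimately have "omega_pow \<xi> \<le> \<xi>"
    unfolding omega_pow.simps[of \<xi>] by (intro Least_le) auto
  then show "omega_pow \<xi> = \<xi>"
    using strict_mono_ge_self[OF strict_mono_omega_pow] by (simp add: antisym)
qed

context
  fixes X :: "cord set"
  assumes unbounded: "\<And>\<beta>. \<exists>\<xi>\<in>X. \<beta> < \<xi>"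
begin

lemma enum_ord_mem: "enum_ord X \<beta> \<in> X"
  and enum_ord_strict: "\<gamma> < \<beta> \<Longrightarrow> enum_ord X \<gamma> < enum_ord X \<beta>"
proof -
  obtain \<delta> where "\<And>\<gamma>. \<gamma> \<in> {..<\<beta>} \<Longrightarrow> enum_ord X \<gamma> < \<delta>"
    by (rule cord_strict_bound[OF countable_lessThan_cord, where f = "enum_ord X"]) blast
  moreover obtain \<xi> where "\<xi> \<in> X" "\<delta> < \<xi>" using unbounded by blast
  ultimately have "\<xi> \<in> X \<and> (\<forall>\<gamma>\<in>{..<\<beta>}. enum_ord X \<gamma> < \<xi>)" by (meson less_trans)
  then have "enum_ord X \<beta> \<in> X \<and> (\<forall>\<gamma>\<in>{..<\<beta>}. enum_ord X \<gamma> < enum_ord X \<beta>)"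
    unfolding enum_ord.simps[of X \<beta>] by (rule LeastI)
  then show "enum_ord X \<beta> \<in> X" "\<gamma> < \<beta> \<Longrightarrow> enum_ord X \<gamma> < enum_ord X \<beta>" by auto
qed

lemma strict_mono_enum_ord: "strict_mono (enum_ord X)"
  by (simp add: enum_ord_strict strict_monoI)

lemma enum_ord_fixpoint:
  assumes "\<xi> \<in> X" "\<And>\<gamma>. \<gamma> < \<xi> \<Longrightarrow> enum_ord X \<gamma> < \<xi>"
  shows "enum_ord X \<xi> = \<xi>"
proof -
  have "enum_ord X \<xi> \<le> \<xi>"
    unfolding enum_ord.simps[of X \<xi>] using assms by (intro Least_le) auto
  then show ?thesis using strict_mono_ge_self[OF strict_mono_enum_ord] by (simp add: antisym)
qed

end

text \<open>Only countably many functions lie below index \<open>\<alpha>\<close>, so one limit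
  above \<open>\<beta>\<close> is closed under all of them, and normality makes it a fixpoint of
  each.\<close>

lemma common_fixpoints_unbounded:
  assumes "\<And>\<gamma>. \<gamma> < \<alpha> \<Longrightarrow> normal_fun (veblen \<gamma>)"
  shows "\<exists>\<xi>\<in>{\<xi>. \<forall>\<gamma>\<in>{..<\<alpha>}. veblen \<gamma> \<xi> = \<xi>}. \<beta> < \<xi>"
proof -
  have "countable (veblen ` {..<\<alpha>})" using countable_lessThan_cord by simp
  then obtain \<xi> where "\<beta> < \<xi>" "limit_ord \<xi>"
    "\<And>f \<gamma>. f \<in> veblen ` {..<\<alpha>} \<Longrightarrow> \<gamma> < \<xi> \<Longrightarrow> f \<gamma> < \<xi>"
    by (rule cord_closure_point[of _ \<beta>]) blast
  then show ?thesis
    using assms unfolding normal_fun_def by (intro bexI[of _ \<xi>]) auto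
qed

lemma normal_fun_veblen: "normal_fun (veblen \<alpha>)"
proof (induction \<alpha> rule: less_induct)
  case (less \<alpha>)
  show ?case
  proof (cases "\<alpha> = 0")
    case True
    then have "veblen \<alpha> = omega_pow" by (subst veblen.simps) simp
    then show ?thesis using normal_fun_omega_pow by simp
  next
    case False
    let ?X = "{\<xi>. \<forall>\<gamma>\<in>{..<\<alpha>}. veblen \<gamma> \<xi> = \<xi>}"
    have unb: "\<exists>\<xi>\<in>?X. \<beta> < \<xi>" for \<beta> by (rule common_fixpoints_unbounded) (rule less.IH)
    have v: "veblen \<alpha> = enum_ord ?X" using False by (subst veblen.simps) simp
    show ?thesis
      unfolding normal_fun_def v
    proof (intro conjI allI impI strict_mono_enum_ord unb enum_ord_fixpoint)
      fix \<xi> assume lim: "limit_ord \<xi>" and closed: "\<forall>\<gamma><\<xi>. enum_ord ?X \<gamma> < \<xi>"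
      \<comment> \<open>Closure under the enumeration implies closure under every lower function:
        \<open>\<beta>\<close> is at most \<open>enum_ord ?X \<beta>\<close>, which is fixed by
        \<open>veblen \<gamma>\<close>.\<close>
      have "veblen \<gamma> \<beta> < \<xi>" if "\<gamma> < \<alpha>" "\<beta> < \<xi>" for \<gamma> \<beta>
      proof -
        have "veblen \<gamma> \<beta> \<le> veblen \<gamma> (enum_ord ?X \<beta>)"
          using less.IH[OF that(1)] strict_mono_ge_self[OF strict_mono_enum_ord[OF unb]]
          unfolding normal_fun_def by (simp add: strict_mono_less_eq)
        also have "\<dots> = enum_ord ?X \<beta>"
          using enum_ord_mem[OF unb] that(1) by blast
        also have "\<dots> < \<xi>" using closed that(2) by blast
        finally show ?thesis .
      qed
      then show "\<xi> \<in> ?X" using less.IH lim unfolding normal_fun_def by auto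
    qed (auto)
  qed
qed

text \<open>Values at a positive index are common fixpoints of the lower functions, in particular of
  \<open>veblen 0 = omega_pow\<close>, hence epsilon numbers.\<close>

lemma omega_pow_veblen:
  assumes "0 < \<alpha>"
  shows "omega_pow (veblen \<alpha> \<beta>) = veblen \<alpha> \<beta>"
proof -
  let ?X = "{\<xi>. \<forall>\<gamma>\<in>{..<\<alpha>}. veblen \<gamma> \<xi> = \<xi>}"
  have "\<alpha> \<noteq> 0" using assms by blast
  then have "veblen \<alpha> = enum_ord ?X" by (subst veblen.simps) simp
  then have "veblen \<alpha> \<beta> = enum_ord ?X \<beta>" by simp
  also have "\<dots> \<in> ?X"
    by (rule enum_ord_mem) (rule common_fixpoints_unbounded, rule normal_fun_veblen)
  finally have "veblen 0 (veblen \<alpha> \<beta>) = veblen \<alpha> \<beta>" using assms by simp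
  moreover have "veblen 0 = omega_pow" by (subst veblen.simps) simp
  ultimately show ?thesis by simp
qed

lemma limit_below_veblen:
  assumes "0 < \<alpha>" "\<gamma> < veblen \<alpha> \<beta>"
  obtains \<kappa> where "\<gamma> < \<kappa>" "\<kappa> < veblen \<alpha> \<beta>" "limit_ord \<kappa>"
proof -
  let ?\<xi> = "veblen \<alpha> \<beta>"
  have below: "\<delta> < omega_pow \<delta> * omega" "limit_ord (omega_pow \<delta> * omega)" for \<delta>
    using strict_mono_ge_self[OF strict_mono_omega_pow, of \<delta>] less_times_omega[OF omega_pow_pos[of \<delta>]]
      limit_ord_times_omega[OF omega_pow_pos] by (auto intro: le_less_trans)
  have le: "omega_pow \<delta> * omega \<le> ?\<xi>" if "\<delta> < ?\<xi>" for \<delta>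
    using omega_pow_times_omega_le[OF that] omega_pow_veblen[OF assms(1)] by simp
  \<comment> \<open>The limit sought is \<open>omega_pow \<gamma> * omega\<close>. The bound
    \<open>le\<close> is not strict, so it is applied to some \<open>\<delta>\<close> strictly
    between \<open>\<gamma>\<close> and that limit.\<close>
  obtain \<delta> where \<delta>: "\<gamma> < \<delta>" "\<delta> < omega_pow \<gamma> * omega"
    using below[of \<gamma>] unfolding limit_ord_def by blast
  have "omega_pow \<gamma> * omega \<le> omega_pow \<delta>" by (rule omega_pow_times_omega_le[OF \<delta>(1)])
  also have "\<dots> < omega_pow \<delta> * omega" by (rule less_times_omega[OF omega_pow_pos])
  also have "\<dots> \<le> ?\<xi>" using le[of \<delta>] le[OF assms(2)] \<delta>(2) by auto
  finally show thesis using that below by blast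
qed

lemma limit_sequence_below_veblen:
  assumes "0 < \<alpha>"
  obtains lam :: "nat \<Rightarrow> cord" where "\<And>j. limit_ord (lam j)" "\<And>j. lam j < lam (Suc j)"
    "\<And>j. lam j < veblen \<alpha> \<beta>"
proof -
  have "0 < veblen \<alpha> \<beta>" using omega_pow_pos[of "veblen \<alpha> \<beta>"] omega_pow_veblen[OF assms, of \<beta>] by simp
  then have "\<exists>\<kappa>. limit_ord \<kappa> \<and> \<kappa> < veblen \<alpha> \<beta>"
    using limit_below_veblen[OF assms] by metis
  moreover have "\<exists>\<kappa>. (limit_ord \<kappa> \<and> \<kappa> < veblen \<alpha> \<beta>) \<and> \<gamma> < \<kappa>" if "\<gamma> < veblen \<alpha> \<beta>" for \<gamma>
    using limit_below_veblen[OF assms that] by metis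
  ultimately have "\<exists>lam. \<forall>j. (limit_ord (lam j) \<and> lam j < veblen \<alpha> \<beta>) \<and> lam j < lam (Suc j)"
    by (intro dependent_nat_choice) auto
  then show thesis using that by blast
qed

lemma zero_less_two_cord: "0 < (1 + 1 :: cord)"
  using zero_less_one_cord plus_cord_lower by (rule less_le_trans)

section \<open>Depth bounds for inferences\<close>

lemma provable_below_infinitary:
  assumes "R P S" "\<And>T. T \<in> P \<Longrightarrow> provable_below R \<mu> T" "\<mu> < \<nu>"
  shows "provable_below R \<nu> S"
proof -
  have "\<forall>T\<in>P. \<exists>\<beta>. \<beta> < \<mu> \<and> proof_of_depth R \<beta> T"
    using assms(2) unfolding provable_below_def by blast
  then obtain d where d: "\<forall>T\<in>P. d T < \<mu> \<and> proof_of_depth R (d T) T"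
    by (rule bchoice[THEN exE])
  then have "proof_of_depth R (slub (d ` P)) S"
    using assms(1) by (auto intro: proof_of_depth.intros)
  moreover have "slub (d ` P) \<le> \<mu>" using d by (auto intro: slub_le)
  ultimately show ?thesis using assms(3) unfolding provable_below_def by (meson le_less_trans)
qed

text \<open>Finitely many depths below a limit have a maximum below it, and the limit leaves room
  for a \<open>\<mu>\<close> above this maximum that bounds the depth of the conclusion.\<close>

lemma provable_below_finitary:
  assumes "R P S" "\<And>T. T \<in> P \<Longrightarrow> provable_below R \<kappa> T" "finite P" "limit_ord \<kappa>"
  shows "provable_below R \<kappa> S"
proof -
  have "\<forall>T\<in>P. \<exists>\<beta>. \<beta> < \<kappa> \<and> proof_of_depth R \<beta> T"
    using assms(2) unfolding provable_below_def by blast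
  then obtain d where d: "\<forall>T\<in>P. d T < \<kappa> \<and> proof_of_depth R (d T) T"
    by (rule bchoice[THEN exE])
  obtain \<mu> where "\<mu> < \<kappa>" "\<And>T. T \<in> P \<Longrightarrow> d T < \<mu>"
  proof (cases "P = {}")
    case True then show ?thesis using that assms(4) unfolding limit_ord_def by auto
  next
    case False
    then have "Max (d ` P) < \<kappa>" using d assms(3) by auto
    then obtain \<mu> where \<mu>: "Max (d ` P) < \<mu>" "\<mu> < \<kappa>"
      using assms(4) unfolding limit_ord_def by blast
    have "d T \<le> Max (d ` P)" if "T \<in> P" for T using that assms(3) by simp
    then show ?thesis using that[of \<mu>] \<mu> by (meson le_less_trans)
  qed
  then show ?thesis
    using provable_below_infinitary[where R = R, OF assms(1), of \<mu> \<kappa>] d unfolding provable_below_def by blast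
qed

lemma provable_below_mono: "provable_below R \<alpha> S \<Longrightarrow> \<alpha> \<le> \<beta> \<Longrightarrow> provable_below R \<beta> S"
  unfolding provable_below_def by (meson less_le_trans)

lemma provable_below_unary:
  "R {T} S \<Longrightarrow> provable_below R \<kappa> T \<Longrightarrow> limit_ord \<kappa> \<Longrightarrow> provable_below R \<kappa> S"
  by (rule provable_below_finitary[where R = R and P = "{T}"]) auto

section \<open>Completeness of leveled calculi\<close>

fun fm_subs :: "('p, 'i) fm \<Rightarrow> ('p, 'i) fm set" where
  "fm_subs (Or A B) = insert (Or A B) (fm_subs A \<union> fm_subs B)"
| "fm_subs (And A B) = insert (And A B) (fm_subs A \<union> fm_subs B)"
| "fm_subs (Dia i A) = insert (Dia i A) (fm_subs A)"
| "fm_subs (Box i A) = insert (Box i A) (fm_subs A)"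
| "fm_subs (DualCK A) = insert (DualCK A) (fm_subs A)"
| "fm_subs (CK A) = insert (CK A) (fm_subs A)"
| "fm_subs F = {F}"

fun prop_subs :: "('p, 'i) fm \<Rightarrow> ('p, 'i) fm set" where
  "prop_subs (Or A B) = insert (Or A B) (prop_subs A \<union> prop_subs B)"
| "prop_subs (And A B) = insert (And A B) (prop_subs A \<union> prop_subs B)"
| "prop_subs F = {F}"

fun prop_size :: "('p, 'i) fm \<Rightarrow> nat" where
  "prop_size (Or A B) = prop_size A + prop_size B + 1"
| "prop_size (And A B) = prop_size A + prop_size B + 1"
| "prop_size F = 0"

text \<open>\<open>T\<close> lists formulas to be made false: literals and modal formulas count as
  false exactly when listed, and \<open>Or\<close> and \<open>And\<close> are evaluated on top of
  that.\<close>

fun refutes :: "('p, 'i) fm set \<Rightarrow> ('p, 'i) fm \<Rightarrow> bool" where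
  "refutes T (Or A B) \<longleftrightarrow> refutes T A \<and> refutes T B"
| "refutes T (And A B) \<longleftrightarrow> refutes T A \<or> refutes T B"
| "refutes T F \<longleftrightarrow> F \<in> T"

definition prop_closed :: "('p, 'i) fm set \<Rightarrow> bool"
  where "prop_closed X \<longleftrightarrow> (\<forall>A B. Or A B \<in> X \<or> And A B \<in> X \<longrightarrow> A \<in> X \<and> B \<in> X)"

lemma self_in_fm_subs: "A \<in> fm_subs A"
  by (cases A) auto

lemma finite_fm_subs: "finite (fm_subs A)"
  by (induction A) auto

lemma fm_subs_trans: "B \<in> fm_subs A \<Longrightarrow> fm_subs B \<subseteq> fm_subs A"
  by (induction A) auto

lemma self_in_prop_subs: "A \<in> prop_subs A"
  by (cases A) auto

lemma finite_prop_subs: "finite (prop_subs A)"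
  by (induction A) auto

lemma prop_subs_trans: "B \<in> prop_subs A \<Longrightarrow> prop_subs B \<subseteq> prop_subs A"
  by (induction A) auto

lemma prop_closed_prop_subs: "prop_closed (prop_subs A)"
  unfolding prop_closed_def using prop_subs_trans self_in_prop_subs by fastforce

lemma prop_closed_fm_subs: "prop_closed (fm_subs A)"
  unfolding prop_closed_def using fm_subs_trans self_in_fm_subs by fastforce

lemma prop_closed_Un: "prop_closed X \<Longrightarrow> prop_closed Y \<Longrightarrow> prop_closed (X \<union> Y)"
  unfolding prop_closed_def by blast

lemma prop_closed_UN: "(\<And>i. i \<in> I \<Longrightarrow> prop_closed (X i)) \<Longrightarrow> prop_closed (\<Union>i\<in>I. X i)"
  unfolding prop_closed_def by blast

lemma refutes_conj_list:
  "L \<noteq> [] \<Longrightarrow> refutes T (conj_list L) \<Longrightarrow> \<exists>A\<in>set L. refutes T A"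
  by (induction L rule: conj_list.induct) auto

lemma refutes_box_all:
  "refutes T (box_all A) \<Longrightarrow> \<exists>i. Box i A \<in> T" for A :: "('p, 'i::{finite,linorder}) fm"
  using refutes_conj_list[of "map (\<lambda>i. Box i A) (sorted_list_of_set UNIV)" T]
  unfolding box_all_def by auto

lemma prop_subs_conj_list:
  "L \<noteq> [] \<Longrightarrow> F \<in> prop_subs (conj_list L) \<Longrightarrow> (\<exists>A B. F = And A B) \<or> (\<exists>A\<in>set L. F \<in> prop_subs A)"
  by (induction L rule: conj_list.induct) auto

lemma prop_subs_box_all:
  "F \<in> prop_subs (box_all A) \<Longrightarrow> (\<exists>B C. F = And B C) \<or> (\<exists>i. F = Box i A)"
  for A :: "('p, 'i::{finite,linorder}) fm"
  using prop_subs_conj_list[of "map (\<lambda>i. Box i A) (sorted_list_of_set UNIV)" F]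
  unfolding box_all_def by fastforce

text \<open>What the premise of the box rule retains besides the body of the box. The body of
  \<open>DualCK B\<close> is included because unfolding \<open>DualCK B\<close> once yields
  \<open>Dia i B\<close>.\<close>

definition box_residue :: "'i \<Rightarrow> ('p, 'i) fm set \<Rightarrow> ('p, 'i) fm set"
  where "box_residue i S =
    {B. Dia i B \<in> S \<or> DualCK B \<in> S} \<union> {F \<in> S. \<exists>B. F = DualCK B}"

lemma inj_Dia: "inj (Dia i)" and inj_DualCK: "inj DualCK"
  by (auto simp: inj_def)

lemma finite_Dia_DualCK:
  assumes "finite S"
  shows "finite {B. Dia i B \<in> S \<or> DualCK B \<in> S}"
proof -
  have "{B. Dia i B \<in> S \<or> DualCK B \<in> S} = Dia i -` S \<union> DualCK -` S" by auto
  then show ?thesis using assms finite_vimageI inj_Dia inj_DualCK by (metis finite_Un)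
qed

lemma finite_box_residue: "finite S \<Longrightarrow> finite (box_residue i S)"
  unfolding box_residue_def by (intro finite_UnI finite_Dia_DualCK) auto

lemma finite_chain_stable:
  fixes P :: "nat \<Rightarrow> 'a set"
  assumes "finite C" "\<And>j. P j \<subseteq> C" "\<And>j. P j \<subseteq> P (Suc j)"
  shows "\<exists>j. P (Suc j) = P j"
proof (rule ccontr)
  assume "\<nexists>j. P (Suc j) = P j"
  then have "P j \<subset> P (Suc j)" for j using assms(3)[of j] by blast
  then have "card (P j) < card (P (Suc j))" for j
    using assms(1,2) by (meson finite_subset psubset_card_mono)
  then have "strict_mono (\<lambda>j. card (P j))" by (simp add: strict_mono_Suc_iff)
  then have "Suc (card C) \<le> card (P (Suc (card C)))" by (rule seq_suble)
  also have "\<dots> \<le> card C" using assms(1,2) by (rule card_mono)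
  finally show False by simp
qed

text \<open>
  \<open>Q j S\<close> stands for provability of all sequents containing \<open>S\<close> with depth below the \<open>j\<close>-th of an
  increasing sequence of limit ordinals: finitary rules stay below a limit, and only the rule for
  \<open>CK\<close> moves on to the next one.
\<close>

locale leveled_calculus =
  fixes Q :: "nat \<Rightarrow> ('p, 'i::{finite,linorder}) fm set \<Rightarrow> bool"
  assumes mono: "Q j S \<Longrightarrow> S \<subseteq> T \<Longrightarrow> Q j T"
    and level: "Q j S \<Longrightarrow> Q (Suc j) S"
    and ax: "Q j {Pos p, Neg p}"
    and disj: "Or A B \<in> S \<Longrightarrow> Q j (insert A (insert B (S - {Or A B}))) \<Longrightarrow> Q j S"
    and conj: "And A B \<in> S \<Longrightarrow> Q j (insert A (S - {And A B})) \<Longrightarrow>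
      Q j (insert B (S - {And A B})) \<Longrightarrow> Q j S"
    and box: "finite S \<Longrightarrow> Box i A \<in> S \<Longrightarrow> Q j (insert A (box_residue i S)) \<Longrightarrow> Q j S"
    and ck: "CK A \<in> S \<Longrightarrow> (\<And>k. k \<ge> 1 \<Longrightarrow> Q j (insert ((box_all ^^ k) A) (S - {CK A}))) \<Longrightarrow>
      Q (Suc j) S"
begin

text \<open>Apply \<open>disj\<close> and \<open>conj\<close> backwards to an unprovable set,
  keeping an unprovable premise each time. The total propositional size decreases until only
  literals and modal formulas remain.\<close>

lemma saturate:
  assumes "finite S" "\<not> Q j S" "S \<subseteq> X" "prop_closed X"
  obtains T where "finite T" "\<not> Q j T" "T \<subseteq> X" "\<And>F. F \<in> T \<Longrightarrow> prop_size F = 0"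
    "\<And>F. F \<in> S \<Longrightarrow> refutes T F"
proof -
  have "\<exists>T. finite T \<and> \<not> Q j T \<and> T \<subseteq> X \<and> (\<forall>F\<in>T. prop_size F = 0) \<and> (\<forall>F\<in>S. refutes T F)"
    using assms
  proof (induction "sum prop_size S" arbitrary: S rule: less_induct)
    case less
    show ?case
    proof (cases "\<forall>F\<in>S. prop_size F = 0")
      case True
      have "refutes S F" if "F \<in> S" for F using True that by (cases F) fastforce+
      then show ?thesis using True less.prems by blast
    next
      case False
      then obtain F where F: "F \<in> S" "prop_size F \<noteq> 0" by blast
      let ?S = "S - {F}"
      have fin: "finite ?S" using less.prems by simp
      have sum: "sum prop_size S = prop_size F + sum prop_size ?S"
        using F less.prems by (simp add: sum.remove)
      \<comment> \<open>Only an inequality: a component may already occur in the set.\<close>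
      have ins: "sum prop_size (insert A U) \<le> prop_size A + sum prop_size U" if "finite U" for A :: "('p,'i) fm" and U
        using that by (cases "A \<in> U") (auto simp: insert_absorb)
      show ?thesis
      proof (cases F)
        case (Or A B)
        let ?U = "insert A (insert B ?S)"
        have "sum prop_size ?U < sum prop_size S"
          using ins[of ?S B] ins[of "insert B ?S" A] fin sum Or by simp
        moreover have "\<not> Q j ?U" using disj[of A B S j] less.prems F Or by blast
        moreover have "?U \<subseteq> X" using less.prems F Or unfolding prop_closed_def by blast
        ultimately obtain T where "finite T \<and> \<not> Q j T \<and> T \<subseteq> X \<and> (\<forall>F\<in>T. prop_size F = 0) \<and> (\<forall>F\<in>?U. refutes T F)"
          using less.hyps[of ?U] fin less.prems(4) by blast
        then show ?thesis using Or by (intro exI[of _ T]) auto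
      next
        case (And A B)
        then obtain C where C: "C = A \<or> C = B" "\<not> Q j (insert C ?S)"
          using conj[of A B S j] less.prems F by blast
        let ?U = "insert C ?S"
        have "sum prop_size ?U < sum prop_size S"
          using ins[of ?S C] fin sum And C by auto
        moreover have "?U \<subseteq> X" using less.prems F And C unfolding prop_closed_def by blast
        ultimately obtain T where "finite T \<and> \<not> Q j T \<and> T \<subseteq> X \<and> (\<forall>F\<in>T. prop_size F = 0) \<and> (\<forall>F\<in>?U. refutes T F)"
          using less.hyps[of ?U] fin less.prems(4) C(2) by blast
        then show ?thesis using And C by (intro exI[of _ T]) auto
      qed (use F in auto)
    qed
  qed
  then show thesis using that by blast
qed

end

section \<open>The countermodel at a stable level\<close>

locale stable_level = leveled_calculus Q
  for Q :: "nat \<Rightarrow> ('p, 'i::{finite,linorder}) fm set \<Rightarrow> bool" +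
  fixes j :: nat and A\<^sub>0 :: "('p, 'i) fm"
  assumes stable: "S \<subseteq> fm_subs A\<^sub>0 \<Longrightarrow> Q (Suc j) S \<Longrightarrow> Q j S"
begin

text \<open>The premises of the infinitary rule leave the subformulas of \<open>A\<^sub>0\<close>,
  so their propositional parts are added. Exponent 0 is covered by \<open>fm_subs\<close>; with the
  extra outer \<open>box_all\<close>, the added parts are only conjunctions and boxed
  formulas.\<close>

definition closure :: "('p, 'i) fm set"
  where "closure = fm_subs A\<^sub>0 \<union> (\<Union>(A, k)\<in>fm_subs A\<^sub>0 \<times> UNIV. prop_subs (box_all ((box_all ^^ k) A)))"

definition world :: "('p, 'i) fm set \<Rightarrow> bool"
  where "world T \<longleftrightarrow> finite T \<and> \<not> Q j T \<and> T \<subseteq> closure \<and> (\<forall>F\<in>T. prop_size F = 0)"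

definition edge :: "'i \<Rightarrow> ('p, 'i) fm set \<Rightarrow> ('p, 'i) fm set \<Rightarrow> bool"
  where "edge i T U \<longleftrightarrow> (\<forall>F\<in>box_residue i T. refutes U F)"

lemma prop_closed_closure: "prop_closed closure"
  unfolding closure_def
  by (intro prop_closed_Un prop_closed_fm_subs prop_closed_UN) (auto simp: prop_closed_prop_subs)

lemma countable_closure: "countable closure"
  unfolding closure_def
  by (intro countable_Un countable_UN countable_SIGMA) (auto simp: finite_fm_subs finite_prop_subs countable_finite)

text \<open>Ensures that the worlds can be represented by the elements of any infinite type.\<close>

lemma countable_worlds: "countable (Collect world)"
  by (rule countable_subset[OF _ countable_Collect_finite_subset[OF countable_closure]])
    (auto simp: world_def)

text \<open>Consequently every \<open>Dia\<close>, \<open>DualCK\<close> or \<open>CK\<close>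
  formula of the closure is a subformula of \<open>A\<^sub>0\<close>.\<close>

lemma closure_cases:
  assumes "F \<in> closure"
  obtains "F \<in> fm_subs A\<^sub>0" | A B where "F = And A B"
  | i A k where "A \<in> fm_subs A\<^sub>0" "F = Box i ((box_all ^^ k) A)"
  using assms prop_subs_box_all unfolding closure_def by blast

lemma box_all_pow_in_closure: "A \<in> fm_subs A\<^sub>0 \<Longrightarrow> (box_all ^^ k) A \<in> closure"
  unfolding closure_def by (cases k) (auto intro!: self_in_prop_subs bexI[of _ A])

text \<open>The residue is formed from \<open>Dia\<close> and \<open>DualCK\<close> formulas only,
  so the iterated boxes outside \<open>fm_subs A\<^sub>0\<close> are forgotten along an
  edge.\<close>

lemma box_residue_closure: "T \<subseteq> closure \<Longrightarrow> box_residue i T \<subseteq> fm_subs A\<^sub>0"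
proof
  fix F assume T: "T \<subseteq> closure" and F: "F \<in> box_residue i T"
  have "G \<in> fm_subs A\<^sub>0" if "G \<in> T" "G = Dia i B \<or> G = DualCK B" for G B
  proof -
    have "G \<in> closure" using that(1) T by blast
    then show ?thesis by (rule closure_cases) (use that(2) in auto)
  qed
  then show "F \<in> fm_subs A\<^sub>0"
    using F fm_subs_trans[of _ A\<^sub>0] self_in_fm_subs unfolding box_residue_def by fastforce
qed

lemma saturate_world:
  assumes "finite S" "\<not> Q j S" "S \<subseteq> closure"
  obtains T where "world T" "\<And>F. F \<in> S \<Longrightarrow> refutes T F"
  using saturate[OF assms prop_closed_closure] unfolding world_def by metis

lemma box_successor:
  assumes "world T" "Box i B \<in> T"
  obtains U where "world U" "edge i T U" "refutes U B"
proof -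
  have T: "finite T" "\<not> Q j T" "T \<subseteq> closure" using assms(1) unfolding world_def by auto
  have "Box i B \<in> closure" using assms(2) T(3) by blast
  then have "B \<in> closure"
  proof (rule closure_cases)
    assume "Box i B \<in> fm_subs A\<^sub>0"
    then have "B \<in> fm_subs A\<^sub>0" using fm_subs_trans self_in_fm_subs[of B] by fastforce
    then show ?thesis unfolding closure_def by blast
  qed (auto intro: box_all_pow_in_closure)
  moreover have "box_residue i T \<subseteq> closure"
    using box_residue_closure[OF T(3)] unfolding closure_def by blast
  moreover have "\<not> Q j (insert B (box_residue i T))" using box[OF T(1) assms(2)] T(2) by blast
  ultimately obtain U where "world U" "\<And>F. F \<in> insert B (box_residue i T) \<Longrightarrow> refutes U F"
    using saturate_world[of "insert B (box_residue i T)"] finite_box_residue[OF T(1)] by blast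
  then show thesis using that unfolding edge_def by blast
qed

definition wedge :: "('p, 'i) fm set \<Rightarrow> ('p, 'i) fm set \<Rightarrow> bool"
  where "wedge T U \<longleftrightarrow> world T \<and> world U \<and> (\<exists>i. edge i T U)"

lemma box_all_path:
  assumes "world T" "refutes T ((box_all ^^ k) A)" 
  shows "\<exists>U. world U \<and> wedge\<^sup>*\<^sup>* T U \<and> refutes U A"
  using assms
proof (induction k arbitrary: T)
  case 0
  then show ?case by auto
next
  case (Suc k)
  then obtain i where "Box i ((box_all ^^ k) A) \<in> T" using refutes_box_all by fastforce
  then obtain U where U: "world U" "edge i T U" "refutes U ((box_all ^^ k) A)"
    using box_successor[OF Suc.prems(1)] by metis
  then have "wedge T U" using Suc.prems(1) unfolding wedge_def by blast
  then show ?case using Suc.IH[OF U(1,3)] by (meson converse_rtranclp_into_rtranclp)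
qed

text \<open>The infinitary rule costs a level, which \<open>stable\<close> restores, but only on
  subformulas; hence \<open>T\<close> is first cut down to \<open>?S\<close>. An unprovable premise
  saturates to a world \<open>V\<close>, which is then bypassed: the first successor of
  \<open>V\<close> is also a successor of \<open>T\<close>.\<close>

lemma ck_path:
  assumes "world T" "CK A \<in> T"
  shows "\<exists>U. world U \<and> wedge\<^sup>+\<^sup>+ T U \<and> refutes U A"
proof -
  have T: "finite T" "\<not> Q j T" "T \<subseteq> closure" using assms(1) unfolding world_def by auto
  let ?S = "T \<inter> fm_subs A\<^sub>0"
  have sub: "CK A \<in> fm_subs A\<^sub>0"
  proof -
    have "CK A \<in> closure" using assms(2) T(3) by blast
    then show ?thesis by (rule closure_cases) auto
  qed
  have "\<not> Q j ?S" using mono[of j ?S T] T(2) by blast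
  then have "\<not> Q (Suc j) ?S" using stable by blast
  then obtain k where k: "k \<ge> 1" "\<not> Q j (insert ((box_all ^^ k) A) (?S - {CK A}))"
    using ck[of A ?S j] assms(2) sub by blast
  have "A \<in> fm_subs A\<^sub>0" using fm_subs_trans[OF sub] self_in_fm_subs[of A] by auto
  then have "(box_all ^^ k) A \<in> closure" by (rule box_all_pow_in_closure)
  then have "insert ((box_all ^^ k) A) (?S - {CK A}) \<subseteq> closure" using T(3) by blast
  then obtain V where V: "world V" "\<And>F. F \<in> insert ((box_all ^^ k) A) (?S - {CK A}) \<Longrightarrow> refutes V F"
    using saturate_world[OF _ k(2)] T(1) by auto
  \<comment> \<open>As \<open>k \<ge> 1\<close>, the path has at least one edge, as
    \<open>wedge\<^sup>+\<^sup>+\<close> demands.\<close>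
  obtain k' where k': "k = Suc k'" using k(1) by (cases k) auto
  then have "refutes V (box_all ((box_all ^^ k') A))" using V(2) by simp
  then obtain i where "Box i ((box_all ^^ k') A) \<in> V" using refutes_box_all by blast
  then obtain U where U: "world U" "edge i V U" "refutes U ((box_all ^^ k') A)"
    using box_successor[OF V(1)] by metis
  \<comment> \<open>The \<open>Dia\<close> and \<open>DualCK\<close> formulas of \<open>T\<close>
    are subformulas of \<open>A\<^sub>0\<close>, so they survive the cut to \<open>?S\<close> and
    belong to \<open>V\<close>.\<close>
  have "G \<in> V" if "G \<in> T" "G = Dia i B \<or> G = DualCK B" for G B
  proof -
    have "G \<in> closure" using that(1) T(3) by blast
    then have "G \<in> fm_subs A\<^sub>0" by (rule closure_cases) (use that(2) in auto)
    then have "refutes V G" using V(2) that by auto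
    then show ?thesis using that(2) by auto
  qed
  then have "box_residue i T \<subseteq> box_residue i V" unfolding box_residue_def by blast
  then have "edge i T U" using U(2) unfolding edge_def by blast
  then have "wedge T U" using assms(1) U(1) unfolding wedge_def by blast
  then show ?thesis using box_all_path[OF U(1,3)] by (meson rtranclp_into_tranclp2)
qed

text \<open>The residue keeps \<open>DualCK B\<close> besides adding \<open>B\<close>, so the
  falsity of \<open>DualCK B\<close> propagates along paths.\<close>

lemma dualck_edge:
  assumes "edge i T U" "DualCK B \<in> T"
  shows "DualCK B \<in> U" "refutes U B"
  using assms unfolding edge_def box_residue_def by force+

lemma dualck_path:
  assumes "wedge\<^sup>+\<^sup>+ T U" "DualCK B \<in> T"
  shows "DualCK B \<in> U \<and> refutes U B"
  using assms by (induction rule: tranclp_induct) (auto simp: wedge_def dest: dualck_edge)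

lemma not_Pos_Neg: "world T \<Longrightarrow> Neg p \<in> T \<Longrightarrow> Pos p \<notin> T"
  using mono[OF ax] unfolding world_def by (metis bot.extremum insert_subset)

lemma countermodel:
  assumes "\<not> Q j {A\<^sub>0}"
  shows "\<not> valid TYPE('s::infinite) A\<^sub>0"
proof -
  obtain T\<^sub>0 where T0: "world T\<^sub>0" "refutes T\<^sub>0 A\<^sub>0"
    using saturate_world[OF _ assms] self_in_fm_subs[of A\<^sub>0] by (auto simp: closure_def)
  obtain f :: "nat \<Rightarrow> 's" where f: "inj f"
    using infinite_UNIV infinite_countable_subset by blast
  let ?w = "from_nat_into (Collect world)"
  \<comment> \<open>The universe may be larger than the set of worlds. All its elements become
    states, and \<open>g\<close> maps them onto the worlds, possibly with repetitions. Outside the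
    range of \<open>f\<close> the value \<open>inv f s\<close> is an arbitrary number, which still
    yields a world.\<close>
  define g where "g s = ?w (inv f s)" for s
  have g: "world (g s)" for s
    unfolding g_def using from_nat_into[of "Collect world"] T0(1) by blast
  have surj: "\<exists>s. g s = T" if "world T" for T
    using that countable_worlds from_nat_into_surj[of "Collect world" T] f unfolding g_def
    by (metis inv_f_f mem_Collect_eq)
  \<comment> \<open>An atom is true unless listed as false. Since \<open>ax\<close> forbids listing
    both \<open>Pos p\<close> and \<open>Neg p\<close>, a listed \<open>Neg p\<close> is false as
    well.\<close>
  define M :: "('s, 'p, 'i) kripke" where
    "M = \<lparr>states = UNIV, acc = (\<lambda>i. {(s, t). edge i (g s) (g t)}), val = (\<lambda>p. {s. Pos p \<notin> g s})\<rparr>"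
  let ?R = "\<Union>i. acc M i"
  have kripke: "is_kripke M" unfolding is_kripke_def M_def by simp
  have R: "(s, t) \<in> ?R \<longleftrightarrow> wedge (g s) (g t)" for s t
    unfolding M_def wedge_def using g by auto
  have path: "wedge\<^sup>+\<^sup>+ (g s) (g t)" if "(s, t) \<in> ?R\<^sup>+" for s t
    using that by (induction rule: trancl_induct) (use R in \<open>blast intro: tranclp.intros\<close>)+
  \<comment> \<open>Edges depend only on \<open>g\<close>, so any preimage of the next world
    continues the path.\<close>
  have lift: "\<exists>t. g t = U \<and> (s, t) \<in> ?R\<^sup>+" if "wedge\<^sup>+\<^sup>+ (g s) U" for s U
    using that
  proof (induction rule: tranclp_induct)
    case (base U)
    then obtain t where "g t = U" using surj unfolding wedge_def by blast
    then show ?case using base R by blast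
  next
    case (step U V)
    then obtain t v where "g t = U" "(s, t) \<in> ?R\<^sup>+" "g v = V" using surj unfolding wedge_def by blast
    then have "(t, v) \<in> ?R" using step.hyps(2) R[of t v] by simp
    then have "(s, v) \<in> ?R\<^sup>+" using \<open>(s, t) \<in> ?R\<^sup>+\<close> by (rule trancl_into_trancl[rotated])
    then show ?case using \<open>g v = V\<close> by blast
  qed
  have "\<not> sat M s F" if "refutes (g s) F" for s F
    using that
  proof (induction F arbitrary: s)
    case (Pos p) then show ?case by (simp add: M_def)
  next
    case (Neg p) then show ?case using not_Pos_Neg[OF g] by (simp add: M_def)
  next
    case (Dia i F)
    have "refutes (g t) F" if "(s, t) \<in> acc M i" for t
      using that Dia.prems unfolding M_def edge_def box_residue_def by auto
    then show ?case using Dia.IH by auto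
  next
    case (Box i F)
    then have "Box i F \<in> g s" by simp
    then obtain U where "world U" "edge i (g s) U" "refutes U F" using box_successor[OF g] by metis
    then obtain t where "(s, t) \<in> acc M i" "refutes (g t) F"
      using surj unfolding M_def by fastforce
    then show ?case using Box.IH by auto
  next
    case (DualCK F)
    then show ?case using path dualck_path by fastforce
  next
    case (CK F)
    then have "CK F \<in> g s" by simp
    then obtain U where "wedge\<^sup>+\<^sup>+ (g s) U" "refutes U F" using ck_path[OF g] by metis
    then obtain t where "(s, t) \<in> ?R\<^sup>+" "refutes (g t) F" using lift by blast
    then show ?case using CK.IH by auto
  qed auto
  moreover obtain s where "g s = T\<^sub>0" using surj T0(1) by blast
  ultimately have "\<not> sat M s A\<^sub>0" using T0(2) by blast
  moreover have "s \<in> states M" by (simp add: M_def)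
  ultimately show ?thesis using kripke unfolding valid_def by blast
qed

end

context leveled_calculus
begin

lemma completeness:
  assumes "valid TYPE('s::infinite) A"
  shows "\<exists>j. Q j {A}"
proof -
  \<comment> \<open>By \<open>level\<close> the provable sets of subformulas form an increasing
    chain inside a finite power set.\<close>
  have "\<exists>j. {S \<in> Pow (fm_subs A). Q (Suc j) S} = {S \<in> Pow (fm_subs A). Q j S}"
    by (rule finite_chain_stable[of "Pow (fm_subs A)"]) (auto simp: finite_fm_subs level)
  then obtain j where j: "{S \<in> Pow (fm_subs A). Q (Suc j) S} = {S \<in> Pow (fm_subs A). Q j S}" ..
  then interpret stable_level Q j A by unfold_locales blast
  show ?thesis using countermodel assms by blast
qed

end

section \<open>Shallow sequents\<close>

lemma mset_splitE:
  assumes "x \<in># M"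
  obtains N where "M = N + {# x #}"
  using multi_member_split[OF assms] by auto

text \<open>The three parts consist of pairwise different formulas, each occurring once, so
  membership in \<open>M\<close> already gives multiset inclusion.\<close>

lemma GC_box_conclusion_subset:
  fixes M :: "('p, 'i) fm multiset"
  assumes "finite D" "finite C" "\<And>B. B \<in> D \<Longrightarrow> Dia i B \<in># M" "\<And>B. B \<in> C \<Longrightarrow> DualCK B \<in># M"
    "Box i A \<in># M"
  shows "image_mset (Dia i) (mset_set D) + image_mset DualCK (mset_set C) + {# Box i A #} \<subseteq># M"
proof -
  have inj: "inj_on (Dia i) D" "inj_on DualCK C" by (auto simp: inj_on_def)
  have "mset_set (Dia i ` D) + mset_set (DualCK ` C) + mset_set {Box i A}
      = mset_set (Dia i ` D \<union> DualCK ` C \<union> {Box i A})"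
    using assms(1,2) by (subst mset_set_Union; auto)+
  also have "\<dots> \<subseteq># mset_set (set_mset M)"
    using assms(3-5) by (intro subset_imp_msubset_mset_set) auto
  also have "\<dots> \<subseteq># M" by (rule mset_set_set_mset_msubset)
  finally show ?thesis using inj by (simp add: image_mset_mset_set)
qed

context
  fixes \<kappa> :: cord
  assumes lim: "limit_ord \<kappa>"
begin

lemma GC_dia_all:
  fixes \<Gamma> :: "('p, 'i::{finite,linorder}) shallow"
  assumes "L \<noteq> []" "provable_below GC \<kappa> (\<Gamma> + mset L)"
  shows "provable_below GC \<kappa> (\<Gamma> + {# disj_list L #})"
  using assms
proof (induction L arbitrary: \<Gamma> rule: disj_list.induct)
  case (2 A B As)
  have "provable_below GC \<kappa> (\<Gamma> + {# A #} + {# disj_list (B # As) #})"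
    using "2.prems" by (intro "2.IH") (simp_all add: add_mset_commute)
  then have "provable_below GC \<kappa> (\<Gamma> + {# A, disj_list (B # As) #})"
    by (simp add: add_mset_commute)
  then have "provable_below GC \<kappa> (\<Gamma> + {# Or A (disj_list (B # As)) #})"
    by (intro provable_below_finitary[where R = GC, OF GC_or _ _ lim]) auto
  then show ?case by simp
qed auto

text \<open>Each \<open>DualCK B\<close> is unfolded by \<open>GC_dualck\<close> and the resulting
  disjunction is split, which supplies \<open>Dia i B\<close>. The disjuncts for the other agents
  accumulate, hence the quantification over all larger \<open>N\<close>.\<close>

lemma GC_unfold_dualck:
  fixes M :: "('p, 'i::{finite,linorder}) shallow"
  assumes "finite V" "\<And>B. B \<in> V \<Longrightarrow> DualCK B \<in># M"
    "\<And>N. M \<subseteq># N \<Longrightarrow> (\<And>B. B \<in> V \<Longrightarrow> Dia i B \<in># N) \<Longrightarrow> provable_below GC \<kappa> N"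
  shows "provable_below GC \<kappa> M"
  using assms
proof (induction V arbitrary: M)
  case empty
  then show ?case by auto
next
  case (insert B V)
  let ?L = "map (\<lambda>i. Dia i B) (sorted_list_of_set UNIV)"
  have "provable_below GC \<kappa> (M + mset ?L)"
  proof (rule insert.IH)
    show "DualCK C \<in># M + mset ?L" if "C \<in> V" for C using insert.prems(1) that by auto
    fix N assume N: "M + mset ?L \<subseteq># N" "\<And>C. C \<in> V \<Longrightarrow> Dia i C \<in># N"
    have "Dia i B \<in># mset ?L" by simp
    then have "Dia i B \<in># N" using N(1) by (meson mset_subset_eqD mset_subset_eq_add_right)
    then show "provable_below GC \<kappa> N"
      using N by (intro insert.prems(2)) (auto intro: subset_mset.order_trans[OF mset_subset_eq_add_left])
  qed
  then have d: "provable_below GC \<kappa> (M + {# dia_all B #})"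
    unfolding dia_all_def by (intro GC_dia_all) auto
  have "DualCK B \<in># M" using insert.prems(1) by simp
  then obtain M' where M: "M = M' + {# DualCK B #}" by (rule mset_splitE)
  have "GC {M' + {# DualCK B, dia_all B #}} M" unfolding M by (rule GC_dualck)
  then show ?case
    by (rule provable_below_finitary[OF _ _ _ lim]) (use d M in \<open>auto simp: add_mset_commute\<close>)
qed

end

text \<open>Quantifying over all multisets that contain the set builds weakening and contraction
  into the notion.\<close>

definition GC_level :: "(nat \<Rightarrow> cord) \<Rightarrow> nat \<Rightarrow> ('p, 'i::{finite,linorder}) fm set \<Rightarrow> bool"
  where "GC_level lam j S \<longleftrightarrow> (\<forall>M. S \<subseteq> set_mset M \<longrightarrow> provable_below GC (lam j) M)"

lemma GC_levelI:
  assumes "F \<in> S"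
    "\<And>M. S - {F} \<subseteq> set_mset M \<Longrightarrow> provable_below GC (lam j) (M + {# F #})"
  shows "GC_level lam j S"
  unfolding GC_level_def
proof (intro allI impI)
  fix M assume M: "S \<subseteq> set_mset M"
  then have "F \<in># M" using assms(1) by blast
  then obtain N where N: "M = N + {# F #}" by (rule mset_splitE)
  show "provable_below GC (lam j) M"
    unfolding N by (rule assms(2)) (use M N in auto)
qed

lemma GC_levelD:
  "GC_level lam j S \<Longrightarrow> S \<subseteq> set_mset M \<Longrightarrow> provable_below GC (lam j) M"
  unfolding GC_level_def by blast

lemma GC_leveled:
  assumes lim: "\<And>j. limit_ord (lam j)" and less: "\<And>j. lam j < lam (Suc j)"
  shows "leveled_calculus (GC_level lam :: nat \<Rightarrow> ('p, 'i::{finite,linorder}) fm set \<Rightarrow> bool)"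
proof
  fix j and S T :: "('p, 'i) fm set"
  show "GC_level lam j T" if "GC_level lam j S" "S \<subseteq> T"
    using that unfolding GC_level_def by blast
  show "GC_level lam (Suc j) S" if "GC_level lam j S"
    using that less[of j] unfolding GC_level_def by (meson less_imp_le provable_below_mono)
  show "GC_level lam j {Pos p, Neg p :: ('p, 'i) fm}" for p
    unfolding GC_level_def
  proof (intro allI impI)
    fix M :: "('p, 'i) shallow" assume "{Pos p, Neg p} \<subseteq> set_mset M"
    then have "Pos p \<in># M" "Neg p \<in># M" by auto
    then obtain M' where M': "M = M' + {# Neg p #}" "Pos p \<in># M'" by (auto elim: mset_splitE)
    then obtain M'' where M'': "M' = M'' + {# Pos p #}" by (auto elim: mset_splitE)
    have "provable_below GC (lam j) (M'' + {# Pos p, Neg p #})"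
      by (rule provable_below_finitary[where R = GC, OF GC_ax _ _ lim]) auto
    then show "provable_below GC (lam j) M" by (simp add: M' M'' add_mset_commute)
  qed
  show "GC_level lam j S"
    if AB: "Or A B \<in> S" and prem: "GC_level lam j (insert A (insert B (S - {Or A B})))" for A B
  proof (rule GC_levelI[OF AB])
    fix M assume "S - {Or A B} \<subseteq> set_mset M"
    then have "provable_below GC (lam j) (M + {# A, B #})"
      by (intro GC_levelD[OF prem]) auto
    then show "provable_below GC (lam j) (M + {# Or A B #})"
      by (intro provable_below_finitary[where R = GC, OF GC_or _ _ lim]) auto
  qed
  show "GC_level lam j S"
    if AB: "And A B \<in> S" and prem: "GC_level lam j (insert A (S - {And A B}))"
      "GC_level lam j (insert B (S - {And A B}))" for A B
  proof (rule GC_levelI[OF AB])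
    fix M assume M: "S - {And A B} \<subseteq> set_mset M"
    have "provable_below GC (lam j) (M + {# A #})"
      by (rule GC_levelD[OF prem(1)]) (use M in auto)
    moreover have "provable_below GC (lam j) (M + {# B #})"
      by (rule GC_levelD[OF prem(2)]) (use M in auto)
    ultimately show "provable_below GC (lam j) (M + {# And A B #})"
      by (intro provable_below_finitary[where R = GC, OF GC_and _ _ lim]) auto
  qed
  show "GC_level lam (Suc j) S"
    if A: "CK A \<in> S" and prem: "\<And>k. k \<ge> 1 \<Longrightarrow> GC_level lam j (insert ((box_all ^^ k) A) (S - {CK A}))" for A
  proof (rule GC_levelI[OF A])
    fix M assume M: "S - {CK A} \<subseteq> set_mset M"
    have "provable_below GC (lam j) (M + {# (box_all ^^ k) A #})" if "k \<ge> 1" for k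
      by (rule GC_levelD[OF prem[OF that]]) (use M in auto)
    then show "provable_below GC (lam (Suc j)) (M + {# CK A #})"
      by (intro provable_below_infinitary[where R = GC, OF GC_ck _ less[of j]]) blast
  qed
  show "GC_level lam j S"
    if fin: "finite S" and A: "Box i A \<in> S" and prem: "GC_level lam j (insert A (box_residue i S))" for i A
    unfolding GC_level_def
  proof (intro allI impI)
    fix M assume M: "S \<subseteq> set_mset M"
    \<comment> \<open>\<open>?D\<close> serves as \<open>\<Gamma>\<close> and \<open>?C\<close> as
      \<open>\<Delta>\<close> in the box rule. The elements of \<open>?C\<close> also belong to
      \<open>?D\<close>, so the \<open>DualCK\<close> formulas are unfolded before the rule is
      applied.\<close>
    let ?D = "{B. Dia i B \<in> S \<or> DualCK B \<in> S}" and ?C = "{B. DualCK B \<in> S}"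
    have finD: "finite ?D" by (rule finite_Dia_DualCK[OF fin])
    then have finC: "finite ?C" by (rule rev_finite_subset) auto
    show "provable_below GC (lam j) M"
    proof (rule GC_unfold_dualck[OF lim finC, where i = i])
      show "DualCK B \<in># M" if "B \<in> ?C" for B using that M by auto
      fix N assume N: "M \<subseteq># N" "\<And>B. B \<in> ?C \<Longrightarrow> Dia i B \<in># N"
      have SN: "F \<in># N" if "F \<in> S" for F using M N(1) that by (meson mset_subset_eqD subsetD)
      let ?G = "mset_set ?D" and ?E = "mset_set ?C"
      have "image_mset (Dia i) ?G + image_mset DualCK ?E + {# Box i A #} \<subseteq># N"
        by (rule GC_box_conclusion_subset[OF finD finC]) (use SN N(2) A in auto)
      then obtain \<Sigma> where \<Sigma>: "N = image_mset (Dia i) ?G + image_mset DualCK ?E + {# Box i A #} + \<Sigma>"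
        by (auto simp: mset_subset_eq_exists_conv)
      have "insert A (box_residue i S) \<subseteq> set_mset (?G + image_mset DualCK ?E + {# A #})"
        using finD finC unfolding box_residue_def by auto
      then have "provable_below GC (lam j) (?G + image_mset DualCK ?E + {# A #})"
        by (rule GC_levelD[OF prem])
      then show "provable_below GC (lam j) N"
        unfolding \<Sigma> by (intro provable_below_finitary[where R = GC, OF GC_box _ _ lim]) auto
    qed
  qed
qed

section \<open>Nested sequents\<close>

primrec hole_fms :: "('p, 'i) ctx \<Rightarrow> ('p, 'i) fm set" where
  "hole_fms (Hole \<Gamma>) = {F. Fm F \<in># \<Gamma>}"
| "hole_fms (Nest \<Gamma> i c) = hole_fms c"

primrec path_dualcks :: "('p, 'i) ctx \<Rightarrow> ('p, 'i) fm set" where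
  "path_dualcks (Hole \<Gamma>) = {B. Fm (DualCK B) \<in># \<Gamma>}"
| "path_dualcks (Nest \<Gamma> i c) = {B. Fm (DualCK B) \<in># \<Gamma>} \<union> path_dualcks c"

text \<open>
  A formula \<open>DualCK B\<close> at any level above the hole is as good as one in the hole, because
  \<open>(dia_all ^^ d) B\<close> can be sent down through \<open>d\<close> brackets.
\<close>

definition available :: "('p, 'i) ctx \<Rightarrow> ('p, 'i) fm set"
  where "available c = hole_fms c \<union> DualCK ` path_dualcks c"

primrec add_hole :: "('p, 'i) nested \<Rightarrow> ('p, 'i) ctx \<Rightarrow> ('p, 'i) ctx" where
  "add_hole \<Delta> (Hole \<Gamma>) = Hole (\<Gamma> + \<Delta>)"
| "add_hole \<Delta> (Nest \<Gamma> i c) = Nest \<Gamma> i (add_hole \<Delta> c)"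

primrec nest_hole :: "'i \<Rightarrow> ('p, 'i) nested \<Rightarrow> ('p, 'i) ctx \<Rightarrow> ('p, 'i) ctx" where
  "nest_hole i \<Delta> (Hole \<Gamma>) = Nest \<Gamma> i (Hole \<Delta>)"
| "nest_hole i \<Delta> (Nest \<Gamma> k c) = Nest \<Gamma> k (nest_hole i \<Delta> c)"

text \<open>The formulas that can be moved into the hole: bodies of \<open>DualCK\<close> formulas
  from any node strictly above it, and bodies of \<open>Dia\<close> formulas from the node directly
  above whose agent labels the last bracket.\<close>

primrec importable :: "('p, 'i) ctx \<Rightarrow> ('p, 'i) fm set" where
  "importable (Hole \<Gamma>) = {}"
| "importable (Nest \<Gamma> i c) = {B. Fm (DualCK B) \<in># \<Gamma>} \<union>
     {B. Fm (Dia i B) \<in># \<Gamma> \<and> (\<exists>\<Delta>. c = Hole \<Delta>)} \<union> importable c"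

text \<open>Backward steps towards the hole add formulas to the nodes on the path but leave the
  brackets of the path in place.\<close>

inductive extends :: "('p, 'i) ctx \<Rightarrow> ('p, 'i) ctx \<Rightarrow> bool" where
  extends_Hole: "\<Gamma> \<subseteq># \<Gamma>' \<Longrightarrow> extends (Hole \<Gamma>) (Hole \<Gamma>')"
| extends_Nest: "\<Gamma> \<subseteq># \<Gamma>' \<Longrightarrow> extends c c' \<Longrightarrow> extends (Nest \<Gamma> i c) (Nest \<Gamma>' i c')"

primrec ctx_depth :: "('p, 'i) ctx \<Rightarrow> nat" where
  "ctx_depth (Hole \<Gamma>) = 0"
| "ctx_depth (Nest \<Gamma> i c) = Suc (ctx_depth c)"

lemma plug_add_hole: "plug (add_hole \<Delta> c) \<Theta> = plug c (\<Delta> + \<Theta>)"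
  by (induction c) (auto simp: add.assoc)

lemma plug_nest_hole: "plug (nest_hole i \<Delta> c) {#} = plug c {# Br i \<Delta> #}"
  by (induction c) auto

lemma hole_fms_add_hole: "hole_fms (add_hole \<Delta> c) = hole_fms c \<union> {F. Fm F \<in># \<Delta>}"
  by (induction c) auto

lemma path_dualcks_add_hole: 
  "path_dualcks (add_hole \<Delta> c) = path_dualcks c \<union> {B. Fm (DualCK B) \<in># \<Delta>}"
  by (induction c) auto

lemma available_add_hole: "available (add_hole \<Delta> c) = available c \<union> {F. Fm F \<in># \<Delta>}"
  unfolding available_def hole_fms_add_hole path_dualcks_add_hole by auto

lemma hole_fms_nest_hole: "hole_fms (nest_hole i \<Delta> c) = {F. Fm F \<in># \<Delta>}"
  by (induction c) auto

lemma path_dualcks_nest_hole: "path_dualcks c \<subseteq> path_dualcks (nest_hole i \<Delta> c)"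
  by (induction c) auto

lemma importable_nest_hole:
  "path_dualcks c \<union> {B. Dia i B \<in> hole_fms c} \<subseteq> importable (nest_hole i \<Delta> c)"
proof (induction c)
  case (Nest \<Gamma> k c)
  then show ?case by auto
qed auto

lemma hole_fms_split:
  "F \<in> hole_fms c \<Longrightarrow> \<exists>c'. c = add_hole {# Fm F #} c'"
proof (induction c)
  case (Hole \<Gamma>)
  then have "Fm F \<in># \<Gamma>" by simp
  then obtain \<Gamma>' where "\<Gamma> = \<Gamma>' + {# Fm F #}" by (rule mset_splitE)
  then show ?case by (intro exI[of _ "Hole \<Gamma>'"]) simp
next
  case (Nest \<Gamma> i c)
  then obtain c' where "c = add_hole {# Fm F #} c'" by auto
  then show ?case by (intro exI[of _ "Nest \<Gamma> i c'"]) simp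
qed

text \<open>Only \<open>DualCK\<close> formulas can be available from above, so \<open>F\<close>
  lies in the hole and can serve as principal formula there.\<close>

lemma available_split:
  assumes "F \<in> available c" "\<And>B. F \<noteq> DualCK B"
  obtains c' where "c = add_hole {# Fm F #} c'" "available c - {F} \<subseteq> available c'"
proof -
  have "F \<in> hole_fms c" using assms unfolding available_def by auto
  then obtain c' where "c = add_hole {# Fm F #} c'" using hole_fms_split by blast
  then show thesis using that by (auto simp: available_add_hole)
qed

text \<open>Lets an induction on a context move the node it leaves behind into the outer context
  \<open>e\<close>.\<close>

lemma plug_outer_Nest: "\<exists>e'. \<forall>\<Delta>. plug e' \<Delta> = plug e (\<Gamma> + {# Br i \<Delta> #})"
proof (induction e)
  case (Hole \<Theta>)
  show ?case by (rule exI[of _ "Nest (\<Theta> + \<Gamma>) i (Hole {#})"]) simp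
next
  case (Nest \<Theta> k e)
  then obtain e' where "\<forall>\<Delta>. plug e' \<Delta> = plug e (\<Gamma> + {# Br i \<Delta> #})" by blast
  then show ?case by (intro exI[of _ "Nest \<Theta> k e'"]) simp
qed

lemma extends_refl: "extends c c"
  by (induction c) (auto intro: extends.intros)

lemma extends_trans: "extends c c' \<Longrightarrow> extends c' c'' \<Longrightarrow> extends c c''"
proof (induction arbitrary: c'' rule: extends.induct)
  case (extends_Hole \<Gamma> \<Gamma>')
  then show ?case by (auto elim!: extends.cases intro!: extends.intros)
next
  case (extends_Nest \<Gamma> \<Gamma>' c c' i)
  from extends_Nest.prems obtain \<Gamma>'' d where "c'' = Nest \<Gamma>'' i d" "\<Gamma>' \<subseteq># \<Gamma>''" "extends c' d"
    by (auto elim: extends.cases)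
  then show ?case using extends_Nest by (auto intro: extends.intros)
qed

lemma extends_mono:
  assumes "extends c c'"
  shows extends_hole_fms: "hole_fms c \<subseteq> hole_fms c'"
    and extends_path_dualcks: "path_dualcks c \<subseteq> path_dualcks c'"
    and extends_importable: "importable c \<subseteq> importable c'"
  using assms by (induction rule: extends.induct) (auto dest: mset_subset_eqD elim: extends.cases)

section \<open>Transporting formulas into the hole\<close>

context
  fixes \<kappa> :: cord
  assumes lim: "limit_ord \<kappa>"
begin

lemma DC_dia_all:
  fixes e :: "('p, 'i::{finite,linorder}) ctx"
  assumes "L \<noteq> []" "provable_below DC \<kappa> (plug e (\<Gamma> + mset (map Fm L)))"
  shows "provable_below DC \<kappa> (plug e (\<Gamma> + {# Fm (disj_list L) #}))"
  using assms
proof (induction L arbitrary: \<Gamma> rule: disj_list.induct)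
  case (2 A B As)
  have "provable_below DC \<kappa> (plug e (\<Gamma> + {# Fm A #} + {# Fm (disj_list (B # As)) #}))"
    using "2.prems" by (intro "2.IH") (simp_all add: add_mset_commute)
  then have "provable_below DC \<kappa> (plug (add_hole \<Gamma> e) {# Fm A, Fm (disj_list (B # As)) #})"
    by (simp add: plug_add_hole add_mset_commute)
  then have "provable_below DC \<kappa> (plug (add_hole \<Gamma> e) {# Fm (Or A (disj_list (B # As))) #})"
    by (intro provable_below_finitary[where R = DC, OF DC_or _ _ lim]) auto
  then show ?case by (simp add: plug_add_hole add_mset_commute)
qed auto

lemma DC_dia_step:
  fixes e :: "('p, 'i::{finite,linorder}) ctx"
  assumes "Fm (Dia i B) \<in># \<Gamma>" "provable_below DC \<kappa> (plug e (\<Gamma> + {# Br i (\<Delta> + {# Fm B #}) #}))"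
  shows "provable_below DC \<kappa> (plug e (\<Gamma> + {# Br i \<Delta> #}))"
proof -
  obtain \<Gamma>' where \<Gamma>: "\<Gamma> = \<Gamma>' + {# Fm (Dia i B) #}" using assms(1) by (rule mset_splitE)
  have "provable_below DC \<kappa> (plug (add_hole \<Gamma>' e) {# Fm (Dia i B), Br i (\<Delta> + {# Fm B #}) #})"
    using assms(2) by (simp add: plug_add_hole \<Gamma> add_mset_commute)
  then have "provable_below DC \<kappa> (plug (add_hole \<Gamma>' e) {# Fm (Dia i B), Br i \<Delta> #})"
    by (intro provable_below_finitary[where R = DC, OF DC_dia _ _ lim]) auto
  then show ?thesis by (simp add: plug_add_hole \<Gamma> add_mset_commute)
qed

text \<open>At a bracket labelled \<open>i\<close>, the disjunction \<open>dia_all\<close> is split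
  and its disjunct for \<open>i\<close> passes its body inside. With exponent
  \<open>ctx_depth c\<close> the formula \<open>B\<close> arrives exactly in the hole. The disjuncts
  stay behind at the nodes passed, hence the premise for all extensions.\<close>

lemma DC_dia_power:
  fixes c :: "('p, 'i::{finite,linorder}) ctx"
  assumes "\<And>c'. extends c c' \<Longrightarrow> B \<in> hole_fms c' \<Longrightarrow> provable_below DC \<kappa> (plug e (plug c' {#}))"
  shows "provable_below DC \<kappa> (plug e (plug c {#} + {# Fm ((dia_all ^^ ctx_depth c) B) #}))"
  using assms
proof (induction c arbitrary: e)
  case (Hole \<Gamma>)
  have "extends (Hole \<Gamma>) (Hole (\<Gamma> + {# Fm B #}))" by (rule extends_Hole) simp
  then show ?case using Hole.prems[of "Hole (\<Gamma> + {# Fm B #})"] by simp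
next
  case (Nest \<Gamma> i c)
  let ?C = "(dia_all ^^ ctx_depth c) B"
  let ?L = "map (\<lambda>i. Dia i ?C) (sorted_list_of_set UNIV)"
  let ?\<Gamma> = "\<Gamma> + mset (map Fm ?L)"
  obtain e' where e': "\<And>\<Delta>. plug e' \<Delta> = plug e (?\<Gamma> + {# Br i \<Delta> #})"
    using plug_outer_Nest[of e "?\<Gamma>" i] by blast
  have "provable_below DC \<kappa> (plug e' (plug c {#} + {# Fm ?C #}))"
  proof (rule Nest.IH)
    fix c' assume c': "extends c c'" "B \<in> hole_fms c'"
    have "provable_below DC \<kappa> (plug e (plug (Nest ?\<Gamma> i c') {#}))"
      by (rule Nest.prems) (use c' in \<open>auto intro: extends_Nest\<close>)
    then show "provable_below DC \<kappa> (plug e' (plug c' {#}))" by (simp add: e')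
  qed
  then have "provable_below DC \<kappa> (plug e (?\<Gamma> + {# Br i (plug c {#}) #}))"
    unfolding e' by (rule DC_dia_step[rotated]) simp
  then have "provable_below DC \<kappa> (plug e (\<Gamma> + {# Br i (plug c {#}) #} + mset (map Fm ?L)))"
    by (simp add: ac_simps)
  then have "provable_below DC \<kappa> (plug e (\<Gamma> + {# Br i (plug c {#}) #} + {# Fm (disj_list ?L) #}))"
    by (rule DC_dia_all[rotated]) simp
  then show ?case by (simp add: dia_all_def[symmetric])
qed

lemma DC_import:
  fixes c :: "('p, 'i::{finite,linorder}) ctx"
  assumes "B \<in> importable c"
    "\<And>c'. extends c c' \<Longrightarrow> B \<in> hole_fms c' \<Longrightarrow> provable_below DC \<kappa> (plug e (plug c' {#}))"
  shows "provable_below DC \<kappa> (plug e (plug c {#}))"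
  using assms
proof (induction c arbitrary: e)
  case (Hole \<Gamma>)
  then show ?case by simp
next
  case (Nest \<Gamma> i c)
  consider "Fm (DualCK B) \<in># \<Gamma>" | \<Delta> where "Fm (Dia i B) \<in># \<Gamma>" "c = Hole \<Delta>" | "B \<in> importable c"
    using Nest.prems(1) by auto
  then show ?case
  proof cases
    case 1
    \<comment> \<open>The exponent is the number of brackets to cross. It is a successor, as
      \<open>DC_dualck\<close> requires \<open>k \<ge> 1\<close>.\<close>
    let ?d = "ctx_depth (Nest \<Gamma> i c)"
    obtain \<Gamma>' where \<Gamma>: "\<Gamma> = \<Gamma>' + {# Fm (DualCK B) #}" using 1 by (rule mset_splitE)
    let ?e = "add_hole (\<Gamma>' + {# Br i (plug c {#}) #}) e"
    have "provable_below DC \<kappa> (plug e (plug (Nest \<Gamma> i c) {#} + {# Fm ((dia_all ^^ ?d) B) #}))"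
      by (rule DC_dia_power) (rule Nest.prems(2))
    then have prem: "provable_below DC \<kappa> (plug ?e {# Fm (DualCK B), Fm ((dia_all ^^ ?d) B) #})"
      by (simp add: plug_add_hole \<Gamma> add_mset_commute)
    have "DC {plug ?e {# Fm (DualCK B), Fm ((dia_all ^^ ?d) B) #}} (plug ?e {# Fm (DualCK B) #})"
      by (rule DC_dualck) simp
    then have "provable_below DC \<kappa> (plug ?e {# Fm (DualCK B) #})"
      using prem lim by (rule provable_below_unary)
    then show ?thesis by (simp add: plug_add_hole \<Gamma> add_mset_commute)
  next
    case 2
    have "provable_below DC \<kappa> (plug e (plug (Nest \<Gamma> i (Hole (\<Delta> + {# Fm B #}))) {#}))"
      by (rule Nest.prems(2)) (simp_all add: 2 extends_Nest extends_Hole)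
    then have "provable_below DC \<kappa> (plug e (\<Gamma> + {# Br i (\<Delta> + {# Fm B #}) #}))" by simp
    then have "provable_below DC \<kappa> (plug e (\<Gamma> + {# Br i \<Delta> #}))" by (rule DC_dia_step[OF 2(1)])
    then show ?thesis using 2(2) by simp
  next
    case 3
    obtain e' where e': "\<And>\<Delta>. plug e' \<Delta> = plug e (\<Gamma> + {# Br i \<Delta> #})"
      using plug_outer_Nest[of e \<Gamma> i] by blast
    have "provable_below DC \<kappa> (plug e' (plug c {#}))"
    proof (rule Nest.IH[OF 3])
      fix c' assume c': "extends c c'" "B \<in> hole_fms c'"
      have "provable_below DC \<kappa> (plug e (plug (Nest \<Gamma> i c') {#}))"
        by (rule Nest.prems(2)) (use c' in \<open>auto intro: extends_Nest\<close>)
      then show "provable_below DC \<kappa> (plug e' (plug c' {#}))" by (simp add: e')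
    qed
    then show ?thesis by (simp add: e')
  qed
qed

lemma DC_import_set:
  fixes c :: "('p, 'i::{finite,linorder}) ctx"
  assumes "finite V" "V \<subseteq> importable c"
    "\<And>c'. extends c c' \<Longrightarrow> V \<subseteq> hole_fms c' \<Longrightarrow> provable_below DC \<kappa> (plug c' {#})"
  shows "provable_below DC \<kappa> (plug c {#})"
  using assms
proof (induction V arbitrary: c)
  case empty
  then show ?case using extends_refl by auto
next
  case (insert B V)
  have "provable_below DC \<kappa> (plug (Hole {#}) (plug c {#}))"
  proof (rule DC_import)
    show "B \<in> importable c" using insert.prems(1) by simp
    fix c' assume c': "extends c c'" "B \<in> hole_fms c'"
    have "provable_below DC \<kappa> (plug c' {#})"
    proof (rule insert.IH)
      show "V \<subseteq> importable c'" using insert.prems(1) extends_importable[OF c'(1)] by auto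
      fix c'' assume c'': "extends c' c''" "V \<subseteq> hole_fms c''"
      then show "provable_below DC \<kappa> (plug c'' {#})"
        using c' extends_hole_fms[OF c''(1)] extends_trans[OF c'(1)] by (intro insert.prems(2)) auto
    qed
    then show "provable_below DC \<kappa> (plug (Hole {#}) (plug c' {#}))" by simp
  qed
  then show ?case by simp
qed

end

text \<open>The hole selects a node at which the set is available, while the rest of the nested
  sequent is arbitrary; again weakening and contraction are built in.\<close>

definition DC_level :: "(nat \<Rightarrow> cord) \<Rightarrow> nat \<Rightarrow> ('p, 'i::{finite,linorder}) fm set \<Rightarrow> bool"
  where "DC_level lam j S \<longleftrightarrow> (\<forall>c. S \<subseteq> available c \<longrightarrow> provable_below DC (lam j) (plug c {#}))"

lemma DC_levelI:
  assumes "F \<in> S" "\<And>B. F \<noteq> DualCK B"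
    "\<And>c. S - {F} \<subseteq> available c \<Longrightarrow> provable_below DC (lam j) (plug c {# Fm F #})"
  shows "DC_level lam j S"
  unfolding DC_level_def
proof (intro allI impI)
  fix c assume c: "S \<subseteq> available c"
  then have "F \<in> available c" using assms(1) by blast
  then obtain c' where c': "c = add_hole {# Fm F #} c'" "available c - {F} \<subseteq> available c'"
    using available_split[OF _ assms(2)] by blast
  have "provable_below DC (lam j) (plug c' {# Fm F #})"
    by (rule assms(3)) (use c c'(2) in blast)
  then show "provable_below DC (lam j) (plug c {#})" by (simp add: c'(1) plug_add_hole)
qed

lemma DC_levelD:
  assumes "DC_level lam j S" "S \<subseteq> available c \<union> {F. Fm F \<in># \<Delta>}"
  shows "provable_below DC (lam j) (plug c \<Delta>)"
proof -
  have "S \<subseteq> available (add_hole \<Delta> c)" using assms(2) by (simp add: available_add_hole)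
  then show ?thesis using assms(1) unfolding DC_level_def by (force simp: plug_add_hole)
qed

lemma DC_leveled:
  assumes lim: "\<And>j. limit_ord (lam j)" and less: "\<And>j. lam j < lam (Suc j)"
  shows "leveled_calculus (DC_level lam :: nat \<Rightarrow> ('p, 'i::{finite,linorder}) fm set \<Rightarrow> bool)"
proof
  fix j and S T :: "('p, 'i) fm set"
  show "DC_level lam j T" if "DC_level lam j S" "S \<subseteq> T"
    using that unfolding DC_level_def by blast
  show "DC_level lam (Suc j) S" if "DC_level lam j S"
    using that less[of j] unfolding DC_level_def by (meson less_imp_le provable_below_mono)
  show "DC_level lam j {Pos p, Neg p :: ('p, 'i) fm}" for p
  proof (rule DC_levelI[of "Pos p"])
    fix c :: "('p, 'i) ctx" assume "{Pos p, Neg p} - {Pos p} \<subseteq> available c"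
    then have "Neg p \<in> available c" by simp
    then obtain c' where c': "c = add_hole {# Fm (Neg p) #} c'"
      by (rule available_split) auto
    have "provable_below DC (lam j) (plug c' {# Fm (Pos p), Fm (Neg p) #})"
      by (rule provable_below_finitary[where R = DC, OF DC_ax _ _ lim]) auto
    then show "provable_below DC (lam j) (plug c {# Fm (Pos p) #})"
      by (simp add: c' plug_add_hole add_mset_commute)
  qed auto
  show "DC_level lam j S"
    if AB: "Or A B \<in> S" and prem: "DC_level lam j (insert A (insert B (S - {Or A B})))" for A B
  proof (rule DC_levelI[OF AB])
    fix c assume "S - {Or A B} \<subseteq> available c"
    then have "provable_below DC (lam j) (plug c {# Fm A, Fm B #})"
      by (intro DC_levelD[OF prem]) auto
    then show "provable_below DC (lam j) (plug c {# Fm (Or A B) #})"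
      by (intro provable_below_finitary[where R = DC, OF DC_or _ _ lim]) auto
  qed simp
  show "DC_level lam j S"
    if AB: "And A B \<in> S" and prem: "DC_level lam j (insert A (S - {And A B}))"
      "DC_level lam j (insert B (S - {And A B}))" for A B
  proof (rule DC_levelI[OF AB])
    fix c assume c: "S - {And A B} \<subseteq> available c"
    have "provable_below DC (lam j) (plug c {# Fm A #})"
      by (rule DC_levelD[OF prem(1)]) (use c in auto)
    moreover have "provable_below DC (lam j) (plug c {# Fm B #})"
      by (rule DC_levelD[OF prem(2)]) (use c in auto)
    ultimately show "provable_below DC (lam j) (plug c {# Fm (And A B) #})"
      by (intro provable_below_finitary[where R = DC, OF DC_and _ _ lim]) auto
  qed simp
  show "DC_level lam (Suc j) S"
    if A: "CK A \<in> S" and prem: "\<And>k. k \<ge> 1 \<Longrightarrow> DC_level lam j (insert ((box_all ^^ k) A) (S - {CK A}))" for A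
  proof (rule DC_levelI[OF A])
    fix c assume c: "S - {CK A} \<subseteq> available c"
    have "provable_below DC (lam j) (plug c {# Fm ((box_all ^^ k) A) #})" if "k \<ge> 1" for k
      by (rule DC_levelD[OF prem[OF that]]) (use c in auto)
    then show "provable_below DC (lam (Suc j)) (plug c {# Fm (CK A) #})"
      by (intro provable_below_infinitary[where R = DC, OF DC_ck _ less[of j]]) blast
  qed simp
  show "DC_level lam j S"
    if fin: "finite S" and A: "Box i A \<in> S" and prem: "DC_level lam j (insert A (box_residue i S))" for i A
  proof (rule DC_levelI[OF A])
    fix c assume c: "S - {Box i A} \<subseteq> available c"
    let ?V = "{B. Dia i B \<in> S \<or> DualCK B \<in> S}"
    \<comment> \<open>Read backwards, the rule opens a new bracket containing \<open>A\<close>. The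
      old hole becomes the node directly above, so its \<open>Dia i\<close> formulas can be
      imported.\<close>
    let ?c = "nest_hole i {# Fm A #} c"
    have dia: "Dia i B \<in> hole_fms c" if "Dia i B \<in> S" for B
      using that c unfolding available_def by auto
    have dualck: "B \<in> path_dualcks c" if "DualCK B \<in> S" for B
    proof -
      have "hole_fms c \<inter> range DualCK \<subseteq> DualCK ` path_dualcks c" by (induction c) auto
      moreover have "DualCK B \<in> available c" using that c by auto
      ultimately show ?thesis unfolding available_def by auto
    qed
    have "provable_below DC (lam j) (plug ?c {#})"
    proof (rule DC_import_set[OF lim finite_Dia_DualCK[OF fin]])
      show "?V \<subseteq> importable ?c"
        using importable_nest_hole[of c i "{# Fm A #}"] dia dualck by blast
      fix c' assume c': "extends ?c c'" "?V \<subseteq> hole_fms c'"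
      have "A \<in> hole_fms c'"
        using extends_hole_fms[OF c'(1)] by (auto simp: hole_fms_nest_hole)
      \<comment> \<open>The \<open>DualCK\<close> formulas of the residue stay where they are: on
        the path they are still available.\<close>
      moreover have "B \<in> path_dualcks c'" if "DualCK B \<in> S" for B
        by (rule subsetD[OF extends_path_dualcks[OF c'(1)]],
            rule subsetD[OF path_dualcks_nest_hole]) (rule dualck[OF that])
      ultimately have "insert A (box_residue i S) \<subseteq> available c'"
        using c'(2) unfolding available_def box_residue_def by auto
      then show "provable_below DC (lam j) (plug c' {#})" using prem unfolding DC_level_def by blast
    qed
    then show "provable_below DC (lam j) (plug c {# Fm (Box i A) #})"
      by (intro provable_below_finitary[where R = DC, OF DC_box _ _ lim]) (auto simp: plug_nest_hole)
  qed simp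
qed

theorem theorem3p23:
  fixes A :: "('p, 'i::{finite,linorder}) fm"
  assumes "valid TYPE('s::infinite) A"
  shows "provable_below DC (veblen (1 + 1) 0) {# Fm A #} \<and>
    provable_below GC (veblen (1 + 1) 0) {# A #}"
proof -
  obtain lam where lam: "\<And>j. limit_ord (lam j)" "\<And>j. lam j < lam (Suc j)"
    "\<And>j. lam j < veblen (1 + 1) 0"
    by (rule limit_sequence_below_veblen[OF zero_less_two_cord, where \<beta> = 0]) blast
  interpret D: leveled_calculus "DC_level lam :: nat \<Rightarrow> ('p, 'i) fm set \<Rightarrow> bool"
    using lam(1,2) by (rule DC_leveled)
  interpret G: leveled_calculus "GC_level lam :: nat \<Rightarrow> ('p, 'i) fm set \<Rightarrow> bool"
    using lam(1,2) by (rule GC_leveled)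
  \<comment> \<open>The two systems share the sequence \<open>lam\<close>, but the levels
    \<open>j\<close> and \<open>k\<close> may differ; both lie below
    \<open>veblen (1 + 1) 0\<close>.\<close>
  obtain j where "DC_level lam j {A}" using D.completeness[OF assms] ..
  then have "provable_below DC (lam j) (plug (Hole {#}) {# Fm A #})"
    by (rule DC_levelD) simp
  moreover obtain k where "GC_level lam k {A}" using G.completeness[OF assms] ..
  then have "provable_below GC (lam k) {# A #}" unfolding GC_level_def by simp
  ultimately show ?thesis using lam(3) by (auto intro: provable_below_mono less_imp_le)
qed

end
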